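(* Consider the SUPER-ADAM algorithm with $\tau=1$ applied to $\min_{x\in\mathbb{R}^d} f(x)=\mathbb{E}_{\xi\sim\mathcal{D}}[f(x;\xi)]$ (that is, $\mathcal{X}=\mathbb{R}^d$). Assume: (1) there is $\sigma>0$ such that for all $x\in\mathbb{R}^d$, $\mathbb{E}[\nabla f(x;\xi)]=\nabla f(x)$ and $\mathbb{E}\|\nabla f(x;\xi)-\nabla f(x)\|^2\le\sigma^2$; (2) $f$ is bounded below, with $f^*=\inf_{x\in\mathbb{R}^d}f(x)>-\infty$; (3) there is $\rho>0$ such that $H_t\succeq\rho I_d$ for all $t\ge1$; (4) there is $L>0$ such that for every $\xi$, $\|\nabla f(x;\xi)-\nabla f(y;\xi)\|\le L\|x-y\|$ for all $x,y\in\mathbb{R}^d$. Let $k>0$, $m\ge\max\big(\tfrac32,\,k^3,\,\tfrac{8^{3/2}}{(3k)^{3/2}}\big)$, $\gamma=\frac{\rho m^{1/3}}{\nu kL}$ with $\nu\ge4$, $\frac{1}{k^3}+\frac{10L^2\gamma^2}{\rho^2}\le c\le\frac{m^{2/3}}{k^2}$, and for all $t\ge0$ let $\mu_t=\frac{k}{(m+t)^{1/3}}$ and $\alpha_{t+1}=c\mu_t^2$. Then for every integer $T\ge1$, $$\frac1T\sum_{t=1}^T\mathbb{E}\|\nabla f(x_t)\|\le\frac{\sqrt{\frac1T\sum_{t=1}^T\mathbb{E}\|H_t\|^2}}{\rho}\left(\frac{2\sqrt{2G'}}{T^{1/2}}+\frac{2\sqrt{2G'}}{m^{1/6}T^{1/3}}\right),$$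 where $G'=\nu L(f(x_1)-f^* )+\frac{\nu^2\sigma^2}{8}+\frac{\nu^2k^4c^2\sigma^2}{4m^{1/3}}\ln(m+T)$.
   Context: Norms: $\|\cdot\|$ is the $\ell_2$ norm for vectors and the spectral norm for matrices. $f(\cdot;\xi)$ and $f$ are differentiable, and $f$ may be nonconvex; gradients are with respect to $x$. SUPER-ADAM algorithm (for a feasible set $\mathcal{X}$, here $\mathcal{X}=\mathbb{R}^d$). Inputs: $\tau\in\{0,1\}$, constant $\gamma>0$, parameters $\mu_t\in(0,1]$, $\alpha_{t+1}\in(0,1]$, and a deterministic starting point $x_1\in\mathcal{X}$. The samples $\xi_1,\xi_2,\dots$ are drawn independently from $\mathcal{D}$. Set $g_1=\nabla f(x_1;\xi_1)$. For $t=1,2,\dots$: (i) generate a symmetric matrix $H_t\in\mathbb{R}^{d\times d}$ by any rule depending (measurably) only on the information available so far, i.e. on $\xi_1,\dots,\xi_t$; (ii) $\tilde{x}_{t+1}=\arg\min_{x\in\mathcal{X}}\{\langle g_t,x\rangle+\frac{1}{2\gamma}(x-x_t)^TH_t(x-x_t)\}$; (iii) $x_{t+1}=(1-\mu_t)x_t+\mu_t\tilde{x}_{t+1}$; (iv) draw $\xi_{t+1}$ and set $g_{t+1}=\alpha_{t+1}\nabla f(x_{t+1};\xi_{t+1})+(1-\alpha_{t+1})\big[g_t+\tau\big(\nabla f(x_{t+1};\xi_{t+1})-\nabla f(x_t;\xi_{t+1})\big)\big]$. $\mathbb{E}$ denotes expectation over all the samples; the right-hand side of the bound is allowed to be $+\infty$.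 *)

theory Defs
  imports "HOL-Probability.Probability"
begin

definition grad :: "(real ^ 'n \<Rightarrow> real) \<Rightarrow> real ^ 'n \<Rightarrow> real ^ 'n" where
  "grad f x = (THE v. GDERIV f x :> v)"

definition spectral_norm :: "real ^ 'n ^ 'n \<Rightarrow> real" where
  "spectral_norm A = onorm ((*v) A)"

definition loewner_le :: "real ^ 'n ^ 'n \<Rightarrow> real ^ 'n ^ 'n \<Rightarrow> bool" where
  "loewner_le A B \<longleftrightarrow> transpose (B - A) = B - A \<and> (\<forall>v. 0 \<le> v \<bullet> ((B - A) *v v))"

definition ennreal_sqrt :: "ennreal \<Rightarrow> ennreal" where
  "ennreal_sqrt a = (if a = \<infinity> then \<infinity> else ennreal (sqrt (enn2real a)))"

text \<open>
  A run of the algorithm, over a probability space \<open>M\<close>. The loss is \<open>F x s\<close>, where \<open>s\<close> is a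
  sample; the samples \<open>\<xi> 1, \<xi> 2, \<dots>\<close> are independent with law \<open>D\<close>. The rule that generates
  \<open>H t\<close> is an arbitrary Borel function of the tuple \<open>(\<xi> 1, \<dots>, \<xi> t)\<close>. The sequence \<open>xt\<close>
  holds the minimizers (the iterates with a tilde) and \<open>X\<close> is the feasible set. The sequences
  \<open>\<xi>\<close>, \<open>H\<close>, \<open>x\<close>, \<open>g\<close> start at index 1 and \<open>xt\<close> starts at index 2; earlier values are unconstrained.
\<close>

definition super_adam ::
  "'a measure \<Rightarrow> 'b measure \<Rightarrow> (real ^ 'n \<Rightarrow> 'b \<Rightarrow> real) \<Rightarrow> (real ^ 'n) set \<Rightarrow> real \<Rightarrow> real
    \<Rightarrow> (nat \<Rightarrow> real) \<Rightarrow> (nat \<Rightarrow> real) \<Rightarrow> real ^ 'n \<Rightarrow> (nat \<Rightarrow> 'a \<Rightarrow> 'b)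
    \<Rightarrow> (nat \<Rightarrow> 'a \<Rightarrow> real ^ 'n ^ 'n) \<Rightarrow> (nat \<Rightarrow> 'a \<Rightarrow> real ^ 'n) \<Rightarrow> (nat \<Rightarrow> 'a \<Rightarrow> real ^ 'n)
    \<Rightarrow> (nat \<Rightarrow> 'a \<Rightarrow> real ^ 'n) \<Rightarrow> bool" where
  "super_adam M D F X \<tau> \<gamma> \<mu> \<alpha> x\<^sub>1 \<xi> H xt x g \<longleftrightarrow>
     \<tau> \<in> {0, 1} \<and> 0 < \<gamma> \<and> (\<forall>t\<ge>1. \<mu> t \<in> {0<..1} \<and> \<alpha> (t + 1) \<in> {0<..1}) \<and> x\<^sub>1 \<in> X \<and>
     prob_space M \<and> prob_space D \<and>
     prob_space.indep_vars M (\<lambda>_. D) \<xi> {1..} \<and> (\<forall>t\<ge>1. distr M D (\<xi> t) = D) \<and>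
     (\<forall>\<omega>\<in>space M. x 1 \<omega> = x\<^sub>1 \<and> g 1 \<omega> = grad (\<lambda>y. F y (\<xi> 1 \<omega>)) x\<^sub>1) \<and>
     (\<forall>t\<ge>1. \<exists>R \<in> borel_measurable (\<Pi>\<^sub>M i\<in>{1..t}. D).
        \<forall>\<omega>\<in>space M. H t \<omega> = R (\<lambda>i\<in>{1..t}. \<xi> i \<omega>)) \<and>
     (\<forall>t\<ge>1. \<forall>\<omega>\<in>space M.
        transpose (H t \<omega>) = H t \<omega> \<and>
        is_arg_min
          (\<lambda>y. g t \<omega> \<bullet> y + 1 / (2 * \<gamma>) * ((y - x t \<omega>) \<bullet> (H t \<omega> *v (y - x t \<omega>))))
          (\<lambda>y. y \<in> X) (xt (t + 1) \<omega>) \<and>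
        x (t + 1) \<omega> = (1 - \<mu> t) *\<^sub>R x t \<omega> + \<mu> t *\<^sub>R xt (t + 1) \<omega> \<and>
        g (t + 1) \<omega> =
          \<alpha> (t + 1) *\<^sub>R grad (\<lambda>y. F y (\<xi> (t + 1) \<omega>)) (x (t + 1) \<omega>) +
          (1 - \<alpha> (t + 1)) *\<^sub>R (g t \<omega> + \<tau> *\<^sub>R
            (grad (\<lambda>y. F y (\<xi> (t + 1) \<omega>)) (x (t + 1) \<omega>) -
             grad (\<lambda>y. F y (\<xi> (t + 1) \<omega>)) (x t \<omega>))))"

end

theory Submission
  imports Defs
begin

text \<open>
  Let \<open>e\<^sub>t = \<nabla>f(x\<^sub>t) - g\<^sub>t\<close> and let \<open>d\<^sub>t\<close> be the step from \<open>x\<^sub>t\<close> to the minimizer of the quadratic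
  model, so that \<open>H\<^sub>t d\<^sub>t = - \<gamma> g\<^sub>t\<close>. Smoothness and \<open>H\<^sub>t \<ge> \<rho>\<close> give
  \<open>f(x\<^sub>t\<^sub>+\<^sub>1) + \<rho>\<mu>\<^sub>t/(2\<gamma>) |d\<^sub>t|\<^sup>2 \<le> f(x\<^sub>t) + \<gamma>\<mu>\<^sub>t/\<rho> |e\<^sub>t|\<^sup>2\<close>. As \<open>x\<^sub>t\<^sub>+\<^sub>1\<close> and \<open>g\<^sub>t\<close> depend on \<open>\<xi>\<^sub>1, \<dots>, \<xi>\<^sub>t\<close> only,
  the new noise is centred given the past, whence
  \<open>E|e\<^sub>t\<^sub>+\<^sub>1|\<^sup>2 \<le> (1 - \<alpha>\<^sub>t\<^sub>+\<^sub>1)\<^sup>2 E|e\<^sub>t|\<^sup>2 + 2\<alpha>\<^sub>t\<^sub>+\<^sub>1\<^sup>2\<sigma>\<^sup>2 + 2(1 - \<alpha>\<^sub>t\<^sub>+\<^sub>1)\<^sup>2L\<^sup>2\<mu>\<^sub>t\<^sup>2 E|d\<^sub>t|\<^sup>2\<close>. In the Lyapunov function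
  \<open>E f(x\<^sub>t) + \<rho>/(8\<gamma>L\<^sup>2\<mu>\<^sub>t\<^sub>-\<^sub>1) E|e\<^sub>t|\<^sup>2\<close> the weight makes the \<open>d\<close>-term of the second recursion cost half
  of the gain of the first one, and the lower bound on \<open>c\<close> makes the \<open>e\<close>-terms decrease. Summation
  bounds the mean of \<open>E(|e\<^sub>t|/\<rho> + |d\<^sub>t|/\<gamma>)\<^sup>2\<close>; since \<open>|\<nabla>f(x\<^sub>t)| \<le> |H\<^sub>t| (|e\<^sub>t|/\<rho> + |d\<^sub>t|/\<gamma>)\<close>, the
  Cauchy-Schwarz inequality concludes.
\<close>

section \<open>Gradients and matrices\<close>

text \<open>The derivative is a linear functional, so it is the inner product with its adjoint at 1.
  Uniqueness of derivatives makes the definite description in \<open>grad\<close> denote that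
  vector.\<close>

lemma gderiv_grad:
  assumes "f differentiable (at x)"
  shows "GDERIV f x :> grad f x"
proof -
  obtain f' where f': "(f has_derivative f') (at x)"
    using assms by (auto simp: differentiable_def)
  then have "linear f'" by (rule has_derivative_linear)
  then have "f' = (\<lambda>h. h \<bullet> adjoint f' 1)" by (simp add: adjoint_works)
  with f' have "GDERIV f x :> adjoint f' 1" by (simp add: gderiv_def)
  moreover have "v = w" if "GDERIV f x :> v" "GDERIV f x :> w" for v w
  proof -
    have "(\<lambda>h. h \<bullet> v) = (\<lambda>h. h \<bullet> w)"
      using that unfolding gderiv_def by (rule has_derivative_unique)
    then show ?thesis by (metis vector_eq_ldot)
  qed
  ultimately show ?thesis unfolding grad_def by (metis the_equality)
qed

lemma descent_lemma:
  assumes f: "\<And>y. f differentiable (at y)"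
    and lip: "\<And>y z. norm (grad f y - grad f z) \<le> L * norm (y - z)"
  shows "f (x + d) \<le> f x + grad f x \<bullet> d + L / 2 * (norm d)\<^sup>2"
proof -
  \<comment> \<open>The claim is \<open>\<phi> 1 \<le> \<phi> 0\<close>. Along the segment the
    derivative of \<open>\<phi>\<close> is the change of the directional derivative minus its
    Lipschitz bound, hence not positive; no integral is required.\<close>
  define \<phi> where "\<phi> s = f (x + s *\<^sub>R d) - s * (grad f x \<bullet> d) - s\<^sup>2 * (L / 2 * (norm d)\<^sup>2)" for s
  have der: "(\<phi> has_real_derivative
      d \<bullet> grad f (x + s *\<^sub>R d) - grad f x \<bullet> d - s * L * (norm d)\<^sup>2) (at s)" for s
  proof -
    have *: "(f has_derivative (\<lambda>h. h \<bullet> grad f (x + s *\<^sub>R d))) (at (x + s *\<^sub>R d))"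
      using gderiv_grad[OF f] by (simp add: gderiv_def)
    have "((\<lambda>s. f (x + s *\<^sub>R d)) has_derivative (\<lambda>h. (h *\<^sub>R d) \<bullet> grad f (x + s *\<^sub>R d))) (at s)"
      by (rule has_derivative_compose[where f = "\<lambda>s. x + s *\<^sub>R d" and g = f and g' = "\<lambda>h. h \<bullet> grad f (x + s *\<^sub>R d)"])
        (auto intro!: derivative_eq_intros *)
    then have "((\<lambda>s. f (x + s *\<^sub>R d)) has_real_derivative d \<bullet> grad f (x + s *\<^sub>R d)) (at s)"
      by (rule has_derivative_imp_has_field_derivative) simp
    then show ?thesis unfolding \<phi>_def
      by (auto intro!: derivative_eq_intros simp: algebra_simps)
  qed
  have "\<phi> 1 \<le> \<phi> 0"
  proof (rule DERIV_nonpos_imp_nonincreasing[of 0 1 \<phi>])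
    fix s :: real assume s: "0 \<le> s" "s \<le> 1"
    have "d \<bullet> grad f (x + s *\<^sub>R d) - grad f x \<bullet> d = d \<bullet> (grad f (x + s *\<^sub>R d) - grad f x)"
      by (simp add: inner_diff_right inner_commute)
    also have "\<dots> \<le> norm d * norm (grad f (x + s *\<^sub>R d) - grad f x)"
      by (rule norm_cauchy_schwarz)
    also have "\<dots> \<le> norm d * (L * norm ((x + s *\<^sub>R d) - x))"
      by (intro mult_left_mono lip) auto
    also have "\<dots> = s * L * (norm d)\<^sup>2"
      using s by (simp add: power2_eq_square)
    finally show "\<exists>y. (\<phi> has_real_derivative y) (at s) \<and> y \<le> 0" using der[of s] by force
  qed simp
  then show ?thesis by (simp add: \<phi>_def)
qed

section \<open>First-order condition of the quadratic subproblem\<close>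

lemma linear_term_eq_0:
  fixes a b :: real
  assumes "\<And>s. 0 \<le> s * a + s\<^sup>2 * b"
  shows "a = 0"
proof (rule ccontr)
  assume a: "a \<noteq> 0"
  \<comment> \<open>\<open>K\<close> is positive and exceeds \<open>b\<close> whatever the sign of
    \<open>b\<close>. The choice of \<open>s\<close> makes \<open>s\<^sup>2 * K\<close> cancel the
    linear term exactly, so the smaller \<open>s\<^sup>2 * b\<close> leaves a negative
    value.\<close>
  define K where "K = \<bar>b\<bar> + 1"
  define s where "s = - a / K"
  have K: "0 < K" "b < K" by (auto simp: K_def)
  have "s\<^sup>2 * b < s\<^sup>2 * K" using K a by (intro mult_strict_left_mono) (auto simp: s_def)
  also have "s\<^sup>2 * K = - (s * a)" using K by (simp add: s_def power2_eq_square)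
  finally show False using assms[of s] by simp
qed

text \<open>The minimizer is perturbed along \<open>w\<close>, the candidate gradient itself. The
  increase of the objective is a polynomial in the step length whose linear coefficient is
  \<open>w \<bullet> w\<close>, and minimality makes it nonnegative everywhere.\<close>

lemma quadratic_arg_min_gradient:
  fixes H :: "real ^ 'n ^ 'n"
  assumes sym: "transpose H = H"
    and min: "is_arg_min (\<lambda>y. g \<bullet> y + r * ((y - x) \<bullet> (H *v (y - x)))) (\<lambda>y. y \<in> UNIV) z"
  shows "g + (2 * r) *\<^sub>R (H *v (z - x)) = 0"
proof -
  define q where "q y = g \<bullet> y + r * ((y - x) \<bullet> (H *v (y - x)))" for y
  define w where "w = g + (2 * r) *\<^sub>R (H *v (z - x))"
  have ge: "q z \<le> q y" for y
    using min by (force simp: is_arg_min_linorder q_def)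
  have "0 \<le> s * (w \<bullet> w) + s\<^sup>2 * (r * (w \<bullet> (H *v w)))" for s
  proof -
    \<comment> \<open>Symmetry of \<open>H\<close> merges the two cross terms of the expanded
      quadratic form.\<close>
    have sw: "(z - x) \<bullet> (H *v w) = w \<bullet> (H *v (z - x))"
      by (metis dot_lmul_matrix inner_commute sym transpose_matrix_vector)
    have e: "z + s *\<^sub>R w - x = (z - x) + s *\<^sub>R w" by simp
    have 1: "w \<bullet> w = g \<bullet> w + 2 * r * (w \<bullet> (H *v (z - x)))"
      by (subst (2) w_def) (simp add: inner_add_right inner_commute[of w g])
    have 2: "(z + s *\<^sub>R w - x) \<bullet> (H *v (z + s *\<^sub>R w - x))
        = (z - x) \<bullet> (H *v (z - x)) + 2 * s * (w \<bullet> (H *v (z - x))) + s\<^sup>2 * (w \<bullet> (H *v w))"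
      unfolding e by (simp only: matrix_vector_right_distrib matrix_vector_mult_scaleR
        inner_add_left inner_add_right sw inner_scaleR_left inner_scaleR_right)
        (simp add: power2_eq_square algebra_simps)
    have "q (z + s *\<^sub>R w) - q z = s * (w \<bullet> w) + s\<^sup>2 * (r * (w \<bullet> (H *v w)))"
      unfolding q_def 2 1 by (simp add: inner_add_right algebra_simps)
    with ge[of "z + s *\<^sub>R w"] show ?thesis by simp
  qed
  then have "w \<bullet> w = 0" by (rule linear_term_eq_0)
  then show ?thesis by (simp add: w_def)
qed

section \<open>Measurability of composed functions and of solutions of linear systems\<close>

text \<open>Joint measurability is what permits sample gradients to be evaluated at random iterates.
  The point \<open>y\<close> is approximated by points of a countable dense set; each approximant
  takes countably many values in its first argument, and continuity gives pointwise
  convergence.\<close>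

lemma borel_measurable_Caratheodory:
  fixes h :: "'x :: {second_countable_topology, metric_space} \<Rightarrow> 'b \<Rightarrow> 'c :: metric_space"
  assumes meas: "\<And>y. h y \<in> borel_measurable D"
    and cont: "\<And>s. s \<in> space D \<Longrightarrow> continuous_on UNIV (\<lambda>y. h y s)"
  shows "(\<lambda>(y, s). h y s) \<in> borel_measurable (borel \<Otimes>\<^sub>M D)"
proof -
  obtain E :: "'x set" where E: "countable E" "\<And>X. open X \<Longrightarrow> X \<noteq> {} \<Longrightarrow> \<exists>d\<in>E. d \<in> X"
    using countable_dense_setE by blast
  define e where "e = from_nat_into E"
  have ex: "\<exists>j. dist y (e j) < 1 / Suc n" for y n
  proof -
    obtain d where "d \<in> E" "d \<in> ball y (1 / Suc n)"
      using E(2)[of "ball y (1 / Suc n)"] by (metis centre_in_ball divide_pos_pos empty_iff of_nat_0_less_iff open_ball zero_less_Suc zero_less_one)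
    then show ?thesis
      using from_nat_into_surj[OF E(1), of d] by (auto simp: e_def)
  qed
  \<comment> \<open>Taking the least admissible index makes the choice of the approximating point
    measurable.\<close>
  define j where "j n y = (LEAST j. dist y (e j) < 1 / Suc n)" for n y
  have j: "dist y (e (j n y)) < 1 / Suc n" for n y
    unfolding j_def by (rule LeastI_ex[OF ex])
  have jm [measurable]: "j n \<in> borel \<rightarrow>\<^sub>M count_space UNIV" for n
    unfolding j_def by measurable
  show ?thesis
  proof (rule borel_measurable_LIMSEQ_metric[where f = "\<lambda>n p. h (e (j n (fst p))) (snd p)"])
    note meas [measurable]
    show "(\<lambda>p. h (e (j n (fst p))) (snd p)) \<in> borel_measurable (borel \<Otimes>\<^sub>M D)" for n
      by (rule measurable_compose_countable) measurable
  next
    fix p :: "'x \<times> 'b" assume "p \<in> space (borel \<Otimes>\<^sub>M D)"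
    then obtain y s where p: "p = (y, s)" and s: "s \<in> space D"
      by (auto simp: space_pair_measure)
    have "(\<lambda>n. dist (e (j n y)) y) \<longlonglongrightarrow> 0"
      by (rule tendsto_sandwich[OF _ _ tendsto_const LIMSEQ_inverse_real_of_nat])
         (use j[of y] in \<open>auto simp: dist_commute less_imp_le inverse_eq_divide\<close>)
    then have "(\<lambda>n. e (j n y)) \<longlonglongrightarrow> y" by (rule tendsto_dist_iff[THEN iffD2])
    with cont[OF s] have "(\<lambda>n. h (e (j n y)) s) \<longlonglongrightarrow> h y s"
      by (rule continuous_on_tendsto_compose) auto
    then show "(\<lambda>n. h (e (j n (fst p))) (snd p)) \<longlonglongrightarrow> (case p of (y, s) \<Rightarrow> h y s)"
      by (simp add: p)
  qed
qed

lemma borel_measurable_vec_component [measurable (raw)]: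
  fixes f :: "'a \<Rightarrow> ('b :: topological_space) ^ 'n"
  assumes "f \<in> borel_measurable M"
  shows "(\<lambda>w. f w $ i) \<in> borel_measurable M"
  by (rule measurable_compose[OF assms]) (auto intro!: borel_measurable_continuous_onI continuous_intros)

lemma borel_measurable_det [measurable (raw)]:
  fixes A :: "'a \<Rightarrow> real ^ 'n ^ 'n"
  assumes "\<And>i j. (\<lambda>w. A w $ i $ j) \<in> borel_measurable M"
  shows "(\<lambda>w. det (A w)) \<in> borel_measurable M"
  unfolding det_def using assms by measurable

lemma borel_measurable_vec_lambda:
  fixes f :: "'n :: finite \<Rightarrow> 'a \<Rightarrow> real"
  assumes "\<And>i. f i \<in> borel_measurable M"
  shows "(\<lambda>w. \<chi> i. f i w) \<in> borel_measurable M"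
  by (subst borel_measurable_euclidean_space) (use assms in \<open>auto simp: Basis_vec_def inner_axis\<close>)

text \<open>Cramer's rule writes each component of \<open>z\<close> as a quotient of determinants,
  which are polynomials in the measurable entries.\<close>

lemma borel_measurable_linear_solution:
  fixes A :: "'a \<Rightarrow> real ^ 'n ^ 'n" and b z :: "'a \<Rightarrow> real ^ 'n"
  assumes [measurable]: "A \<in> borel_measurable M" "b \<in> borel_measurable M"
    and eq: "\<And>w. w \<in> space M \<Longrightarrow> A w *v z w = b w"
    and det: "\<And>w. w \<in> space M \<Longrightarrow> det (A w) \<noteq> 0"
  shows "z \<in> borel_measurable M"
proof -
  have "z w = (\<chi> k. det (\<chi> i j. if j = k then b w $ i else A w $ i $ j) / det (A w))"
    if "w \<in> space M" for w
    using cramer[OF det[OF that]] eq[OF that] by simp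
  moreover have "(\<lambda>w. \<chi> k. det (\<chi> i j. if j = k then b w $ i else A w $ i $ j) / det (A w))
      \<in> borel_measurable M"
  proof (intro borel_measurable_vec_lambda borel_measurable_divide borel_measurable_det)
    fix k i j :: 'n
    show "(\<lambda>w. (\<chi> i j. if j = k then b w $ i else A w $ i $ j) $ i $ j) \<in> borel_measurable M"
      by (cases "j = k") simp_all
  qed measurable
  ultimately show ?thesis by (simp cong: measurable_cong)
qed

section \<open>Spectral norm and Loewner order\<close>

lemma norm_mult_vec_le_spectral_norm: "norm (A *v v) \<le> spectral_norm A * norm v"
  unfolding spectral_norm_def by (rule onorm) (simp add: linear_linear)

text \<open>The operator norm is Lipschitz for the metric of the matrix space: its triangle
  inequality reduces this to a bound on \<open>A - B\<close> through the size of the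
  entries.\<close>

lemma borel_measurable_spectral_norm [measurable]:
  "(spectral_norm :: real ^ 'n ^ 'n \<Rightarrow> real) \<in> borel_measurable borel"
proof (rule borel_measurable_continuous_onI, rule lipschitz_on_continuous_on, rule lipschitz_onI)
  fix A B :: "real ^ 'n ^ 'n"
  let ?C = "real CARD('n) * real CARD('n)"
  have *: "spectral_norm A \<le> spectral_norm B + ?C * dist A B" for A B :: "real ^ 'n ^ 'n"
  proof -
    have "\<bar>(A - B) $ i $ j\<bar> \<le> dist A B" for i j
      using component_le_norm_cart[of "(A - B) $ i" j] Finite_Cartesian_Product.norm_nth_le[of "A - B" i]
      by (simp add: dist_norm)
    then have "onorm ((*v) (A - B)) \<le> ?C * dist A B" by (rule onorm_le_matrix_component)
    moreover have "onorm (\<lambda>v. B *v v + (A - B) *v v) \<le> onorm ((*v) B) + onorm ((*v) (A - B))"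
      by (rule onorm_triangle) (simp_all add: linear_linear)
    ultimately show ?thesis
      by (simp add: spectral_norm_def matrix_vector_mult_diff_rdistrib)
  qed
  show "dist (spectral_norm A) (spectral_norm B) \<le> ?C * dist A B"
    using *[of A B] *[of B A] by (simp add: dist_real_def dist_commute abs_le_iff)
qed simp

lemma loewner_geD:
  assumes "loewner_le (\<rho> *\<^sub>R mat 1) A"
  shows "\<rho> * (norm v)\<^sup>2 \<le> v \<bullet> (A *v v)"
proof -
  have "0 \<le> v \<bullet> ((A - \<rho> *\<^sub>R mat 1) *v v)" using assms by (simp add: loewner_le_def)
  also have "(A - \<rho> *\<^sub>R mat 1) *v v = A *v v - \<rho> *\<^sub>R v"
    by (simp add: matrix_vector_mult_diff_rdistrib scaleR_matrix_vector_assoc [symmetric])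
  finally show ?thesis by (simp add: inner_diff_right power2_norm_eq_inner)
qed

lemma loewner_ge_det_neq_0:
  assumes "loewner_le (\<rho> *\<^sub>R mat 1) A" "0 < \<rho>"
  shows "det A \<noteq> 0"
proof -
  have "v = 0" if "A *v v = 0" for v
    using loewner_geD[OF assms(1), of v] that assms(2) by (simp add: mult_le_0_iff)
  then have "\<exists>B. B ** A = mat 1" by (simp add: matrix_left_invertible_ker)
  then show ?thesis by (simp add: invertible_left_inverse[symmetric] invertible_det_nz)
qed

lemma le_spectral_norm_loewner:
  fixes A :: "real ^ 'n ^ 'n"
  assumes "loewner_le (\<rho> *\<^sub>R mat 1) A"
  shows "\<rho> \<le> spectral_norm A"
proof -
  \<comment> \<open>Any unit vector serves here; an arbitrary coordinate vector is taken.\<close>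
  define v :: "real ^ 'n" where "v = axis undefined 1"
  have "norm v = 1" by (simp add: v_def)
  have "\<rho> \<le> v \<bullet> (A *v v)" using loewner_geD[OF assms, of v] \<open>norm v = 1\<close> by simp
  also have "\<dots> \<le> norm v * norm (A *v v)" by (rule norm_cauchy_schwarz)
  also have "\<dots> \<le> spectral_norm A" using norm_mult_vec_le_spectral_norm[of A v] \<open>norm v = 1\<close> by simp
  finally show ?thesis .
qed

section \<open>Variance of the recursive estimator and independence\<close>

text \<open>In the expanded square the cross term integrates to zero because \<open>N\<close> has
  mean zero.\<close>

lemma (in prob_space) centred_square_integral:
  fixes N :: "'a \<Rightarrow> 'v :: euclidean_space"
  assumes N: "has_bochner_integral M N 0" and N2: "integrable M (\<lambda>s. (norm (N s))\<^sup>2)"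
  shows "has_bochner_integral M (\<lambda>s. (norm (a + N s))\<^sup>2) ((norm a)\<^sup>2 + (\<integral>s. (norm (N s))\<^sup>2 \<partial>M))"
proof -
  have "(norm (a + N s))\<^sup>2 = (norm a)\<^sup>2 + 2 * (a \<bullet> N s) + (norm (N s))\<^sup>2" for s
    by (simp add: power2_norm_eq_inner inner_add_left inner_add_right inner_commute)
  moreover have "has_bochner_integral M (\<lambda>s. (norm a)\<^sup>2 + 2 * (a \<bullet> N s) + (norm (N s))\<^sup>2)
      ((norm a)\<^sup>2 + 2 * (a \<bullet> 0) + (\<integral>s. (norm (N s))\<^sup>2 \<partial>M))"
  proof (intro has_bochner_integral_add has_bochner_integral_mult_right has_bochner_integral_inner_right N)
    show "has_bochner_integral M (\<lambda>s. (norm a)\<^sup>2) ((norm a)\<^sup>2)"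
      by (simp add: has_bochner_integral_iff prob_space)
    show "has_bochner_integral M (\<lambda>s. (norm (N s))\<^sup>2) (\<integral>s. (norm (N s))\<^sup>2 \<partial>M)"
      using N2 by (rule has_bochner_integral_integrable)
  qed
  ultimately show ?thesis by simp
qed

lemma power2_norm_add_le:
  fixes u v :: "'v :: real_inner"
  shows "(norm (u + v))\<^sup>2 \<le> 2 * (norm u)\<^sup>2 + 2 * (norm v)\<^sup>2"
proof -
  have "0 \<le> (norm (u - v))\<^sup>2" by simp
  then show ?thesis
    by (simp add: power2_norm_eq_inner inner_add_left inner_add_right inner_diff_left inner_diff_right)
qed

text \<open>Here \<open>p1\<close> and \<open>p2\<close> are the true gradients at the new and the
  old point, and \<open>g\<close> is the old estimate. The new error is the constant
  \<open>(1 - \<alpha>) *\<^sub>R (p2 - g)\<close> plus the centred noise \<open>N\<close>. The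
  noise combines the sampling error \<open>A\<close> at the new point with the centred gradient
  difference \<open>B\<close>, so no cross term with the old error survives.\<close>

lemma (in prob_space) storm_variance_step:
  fixes h1 h2 :: "'a \<Rightarrow> 'v :: euclidean_space"
  assumes h1: "has_bochner_integral M h1 p1" and h2: "has_bochner_integral M h2 p2"
    and var: "(\<integral>\<^sup>+ s. ennreal ((norm (h1 s - p1))\<^sup>2) \<partial>M) \<le> ennreal (\<sigma>\<^sup>2)"
    and K: "\<And>s. s \<in> space M \<Longrightarrow> norm (h1 s - h2 s) \<le> K"
  shows "(\<integral>\<^sup>+ s. ennreal ((norm (p1 - (\<alpha> *\<^sub>R h1 s + (1 - \<alpha>) *\<^sub>R (g + (h1 s - h2 s)))))\<^sup>2) \<partial>M)
    \<le> ennreal ((1 - \<alpha>)\<^sup>2 * (norm (p2 - g))\<^sup>2 + 2 * \<alpha>\<^sup>2 * \<sigma>\<^sup>2 + 2 * (1 - \<alpha>)\<^sup>2 * K\<^sup>2)"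
proof -
  define A where "A s = p1 - h1 s" for s
  define U where "U s = h1 s - h2 s" for s
  define B where "B s = (p1 - p2) - U s" for s
  define N where "N s = \<alpha> *\<^sub>R A s + (1 - \<alpha>) *\<^sub>R B s" for s
  have [measurable]: "h1 \<in> borel_measurable M" "h2 \<in> borel_measurable M"
    using h1 h2 by (auto dest: borel_measurable_has_bochner_integral)
  have [measurable]: "A \<in> borel_measurable M" "U \<in> borel_measurable M" "B \<in> borel_measurable M"
      "N \<in> borel_measurable M"
    unfolding A_def U_def B_def N_def by measurable
  have const: "has_bochner_integral M (\<lambda>s. p) p" for p :: 'v
    by (simp add: has_bochner_integral_iff prob_space)
  have A: "has_bochner_integral M A 0"
    unfolding A_def using has_bochner_integral_diff[OF const[of p1] h1] by simp
  have U: "has_bochner_integral M U (p1 - p2)"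
    unfolding U_def by (intro has_bochner_integral_diff h1 h2)
  have B: "has_bochner_integral M B 0"
    unfolding B_def using has_bochner_integral_diff[OF const[of "p1 - p2"] U] by simp
  have N: "has_bochner_integral M N 0"
    unfolding N_def
    using has_bochner_integral_add[OF has_bochner_integral_scaleR_right[OF A, of \<alpha>]
        has_bochner_integral_scaleR_right[OF B, of "1 - \<alpha>"]] by simp
  have varA: "(\<integral>\<^sup>+ s. ennreal ((norm (A s))\<^sup>2) \<partial>M) \<le> ennreal (\<sigma>\<^sup>2)"
    using var by (simp add: A_def norm_minus_commute)
  have A2: "integrable M (\<lambda>s. (norm (A s))\<^sup>2)"
  proof (rule integrableI_bounded)
    show "(\<integral>\<^sup>+ s. ennreal (norm ((norm (A s))\<^sup>2)) \<partial>M) < \<infinity>"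
      using varA by (simp add: order_le_less_trans)
  qed measurable
  have A2_le: "(\<integral>s. (norm (A s))\<^sup>2 \<partial>M) \<le> \<sigma>\<^sup>2"
    using varA by (simp add: nn_integral_eq_integral[OF A2])
  have U_le: "(norm (U s))\<^sup>2 \<le> K\<^sup>2" if "s \<in> space M" for s
    using K[OF that] by (simp add: U_def power_mono)
  have U2: "integrable M (\<lambda>s. (norm (U s))\<^sup>2)"
    by (rule integrable_const_bound[where B = "K\<^sup>2"]) (use U_le in \<open>auto\<close>)
  \<comment> \<open>This crude bound only secures integrability; the sharp constant comes
    next.\<close>
  have B2: "integrable M (\<lambda>s. (norm (B s))\<^sup>2)"
  proof (rule integrable_const_bound)
    show "AE s in M. norm ((norm (B s))\<^sup>2) \<le> 2 * (norm (p1 - p2))\<^sup>2 + 2 * K\<^sup>2"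
    proof (intro AE_I2)
      fix s assume "s \<in> space M"
      then show "norm ((norm (B s))\<^sup>2) \<le> 2 * (norm (p1 - p2))\<^sup>2 + 2 * K\<^sup>2"
        using power2_norm_add_le[of "p1 - p2" "- U s"] U_le[of s] by (simp add: B_def)
    qed
  qed measurable
  \<comment> \<open>A variance is at most the second moment: \<open>U\<close> is its mean
    \<open>p1 - p2\<close> plus the centred \<open>- B\<close>, hence the second moment of
    \<open>B\<close> is at most that of \<open>U\<close>, without a factor 2.\<close>
  have B2_le: "(\<integral>s. (norm (B s))\<^sup>2 \<partial>M) \<le> K\<^sup>2"
  proof -
    have "has_bochner_integral M (\<lambda>s. - B s) 0"
      using has_bochner_integral_minus[OF B] by simp
    moreover have "norm (U s - (p1 - p2)) = norm (p1 - p2 - U s)" for s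
      by (rule norm_minus_commute)
    ultimately have "(\<integral>s. (norm (U s))\<^sup>2 \<partial>M) = (norm (p1 - p2))\<^sup>2 + (\<integral>s. (norm (B s))\<^sup>2 \<partial>M)"
      using centred_square_integral[of "\<lambda>s. - B s" "p1 - p2"] B2
      by (simp add: B_def has_bochner_integral_iff)
    moreover have "(\<integral>s. (norm (U s))\<^sup>2 \<partial>M) \<le> (\<integral>s. K\<^sup>2 \<partial>M)"
      by (rule integral_mono[OF U2]) (use U_le in auto)
    ultimately have "(norm (p1 - p2))\<^sup>2 + (\<integral>s. (norm (B s))\<^sup>2 \<partial>M) \<le> K\<^sup>2"
      by (simp add: prob_space)
    then show ?thesis by (rule order_trans[rotated]) simp
  qed
  have N_le: "(norm (N s))\<^sup>2 \<le> 2 * \<alpha>\<^sup>2 * (norm (A s))\<^sup>2 + 2 * (1 - \<alpha>)\<^sup>2 * (norm (B s))\<^sup>2" for s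
    using power2_norm_add_le[of "\<alpha> *\<^sub>R A s" "(1 - \<alpha>) *\<^sub>R B s"]
    by (simp add: N_def power_mult_distrib)
  have AB: "integrable M (\<lambda>s. 2 * \<alpha>\<^sup>2 * (norm (A s))\<^sup>2 + 2 * (1 - \<alpha>)\<^sup>2 * (norm (B s))\<^sup>2)"
    using A2 B2 by simp
  have N2: "integrable M (\<lambda>s. (norm (N s))\<^sup>2)"
    by (rule Bochner_Integration.integrable_bound[OF AB]) (use N_le in \<open>auto intro!: AE_I2 simp: abs_of_nonneg\<close>)
  have "(\<integral>s. (norm (N s))\<^sup>2 \<partial>M) \<le> (\<integral>s. 2 * \<alpha>\<^sup>2 * (norm (A s))\<^sup>2 + 2 * (1 - \<alpha>)\<^sup>2 * (norm (B s))\<^sup>2 \<partial>M)"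
    by (rule integral_mono[OF N2 AB N_le])
  also have "\<dots> = 2 * \<alpha>\<^sup>2 * (\<integral>s. (norm (A s))\<^sup>2 \<partial>M) + 2 * (1 - \<alpha>)\<^sup>2 * (\<integral>s. (norm (B s))\<^sup>2 \<partial>M)"
    using A2 B2 by simp
  also have "\<dots> \<le> 2 * \<alpha>\<^sup>2 * \<sigma>\<^sup>2 + 2 * (1 - \<alpha>)\<^sup>2 * K\<^sup>2"
    by (intro add_mono mult_left_mono A2_le B2_le) auto
  finally have N2_le: "(\<integral>s. (norm (N s))\<^sup>2 \<partial>M) \<le> 2 * \<alpha>\<^sup>2 * \<sigma>\<^sup>2 + 2 * (1 - \<alpha>)\<^sup>2 * K\<^sup>2" .
  have "p1 - (\<alpha> *\<^sub>R h1 s + (1 - \<alpha>) *\<^sub>R (g + (h1 s - h2 s))) = (1 - \<alpha>) *\<^sub>R (p2 - g) + N s" for s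
    by (simp add: N_def A_def B_def U_def algebra_simps)
  then have "(\<integral>\<^sup>+ s. ennreal ((norm (p1 - (\<alpha> *\<^sub>R h1 s + (1 - \<alpha>) *\<^sub>R (g + (h1 s - h2 s)))))\<^sup>2) \<partial>M)
      = ennreal ((norm ((1 - \<alpha>) *\<^sub>R (p2 - g)))\<^sup>2 + (\<integral>s. (norm (N s))\<^sup>2 \<partial>M))"
    using centred_square_integral[OF N N2, of "(1 - \<alpha>) *\<^sub>R (p2 - g)"]
    by (simp add: nn_integral_eq_integral has_bochner_integral_iff)
  also have "\<dots> \<le> ennreal ((1 - \<alpha>)\<^sup>2 * (norm (p2 - g))\<^sup>2 + 2 * \<alpha>\<^sup>2 * \<sigma>\<^sup>2 + 2 * (1 - \<alpha>)\<^sup>2 * K\<^sup>2)"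
    using N2_le by (intro ennreal_leI) (simp add: power_mult_distrib)
  finally show ?thesis .
qed

section \<open>Integration over a fresh independent sample\<close>

text \<open>This form of Fubini's theorem replaces conditional expectation. The integrand keeps
  \<omega> itself as first argument, measurable for the sigma-algebra of the samples in
  \<open>A\<close>, so that the iterates need not be rewritten as functions of the sample
  tuple.\<close>

lemma (in prob_space) nn_integral_fresh_sample:
  assumes ind: "indep_vars (\<lambda>_. D) \<xi> I" and A: "A \<subseteq> I" "j \<in> I - A"
    and k [measurable]: "k \<in> borel_measurable
      (vimage_algebra (space M) (\<lambda>\<omega>. \<lambda>i\<in>A. \<xi> i \<omega>) (\<Pi>\<^sub>M i\<in>A. D) \<Otimes>\<^sub>M D)"
  shows "(\<integral>\<^sup>+ \<omega>. k (\<omega>, \<xi> j \<omega>) \<partial>M) = (\<integral>\<^sup>+ \<omega>. \<integral>\<^sup>+ s. k (\<omega>, s) \<partial>distr M D (\<xi> j) \<partial>M)"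
proof -
  let ?Y = "\<lambda>\<omega>. \<lambda>i\<in>A. \<xi> i \<omega>" and ?Z = "\<lambda>\<omega>. \<lambda>i\<in>{j}. \<xi> i \<omega>"
  define \<F> where "\<F> = vimage_algebra (space M) ?Y (\<Pi>\<^sub>M i\<in>A. D)"
  have \<xi> [measurable]: "\<xi> i \<in> M \<rightarrow>\<^sub>M D" if "i \<in> I" for i
    using ind that by (auto simp: indep_vars_def)
  have j [measurable]: "\<xi> j \<in> M \<rightarrow>\<^sub>M D" using A by auto
  \<comment> \<open>\<open>indep_var\<close> relates variables with values in a common type only, so the fresh sample
    enters as a one-element tuple.\<close>
  have YZ: "indep_var (\<Pi>\<^sub>M i\<in>A. D) ?Y (\<Pi>\<^sub>M i\<in>{j}. D) ?Z"
    using A by (intro indep_var_restrict[OF ind]) auto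
  then have Y: "?Y \<in> M \<rightarrow>\<^sub>M (\<Pi>\<^sub>M i\<in>A. D)" by (rule indep_var_rv1)
  then have Y': "?Y \<in> space M \<rightarrow> space (\<Pi>\<^sub>M i\<in>A. D)" by (auto dest: measurable_space)
  have id [measurable]: "(\<lambda>\<omega>. \<omega>) \<in> M \<rightarrow>\<^sub>M \<F>"
    unfolding \<F>_def using Y by (intro measurable_vimage_algebra2) auto
  have [measurable]: "k \<in> borel_measurable (\<F> \<Otimes>\<^sub>M D)"
    using k by (simp add: \<F>_def)
  interpret F: prob_space "distr M \<F> (\<lambda>\<omega>. \<omega>)" by (rule prob_space_distr) simp
  interpret E: prob_space "distr M D (\<xi> j)" by (rule prob_space_distr) simp
  \<comment> \<open>The joint law of the past and the fresh sample is a product. It suffices to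
    check rectangles, and every past event is a preimage under the tuple \<open>?Y\<close>, to which
    independence applies.\<close>
  have eq: "distr M \<F> (\<lambda>\<omega>. \<omega>) \<Otimes>\<^sub>M distr M D (\<xi> j) = distr M (\<F> \<Otimes>\<^sub>M D) (\<lambda>\<omega>. (\<omega>, \<xi> j \<omega>))"
  proof (rule pair_measure_eqI)
    fix X B assume "X \<in> sets (distr M \<F> (\<lambda>\<omega>. \<omega>))" and "B \<in> sets (distr M D (\<xi> j))"
    then have X: "X \<in> sets \<F>" and B [measurable]: "B \<in> sets D" by auto
    obtain X' where X': "X' \<in> sets (\<Pi>\<^sub>M i\<in>A. D)" "X = ?Y -` X' \<inter> space M"
      using X unfolding \<F>_def sets_vimage_algebra2[OF Y'] by auto
    let ?B = "(\<lambda>f. f j) -` B \<inter> space (\<Pi>\<^sub>M i\<in>{j}. D)"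
    have "?B \<in> sets (\<Pi>\<^sub>M i\<in>{j}. D)" by measurable
    note indep_varD[OF YZ X'(1) this]
    moreover have "?Z -` ?B \<inter> space M = \<xi> j -` B \<inter> space M"
      using measurable_space[OF j] by (auto simp: space_PiM)
    moreover have "(\<lambda>\<omega>. (?Y \<omega>, ?Z \<omega>)) -` (X' \<times> ?B) \<inter> space M = X \<inter> (\<xi> j -` B \<inter> space M)"
      using measurable_space[OF j] by (auto simp: X' space_PiM)
    moreover have "X \<inter> space M = X" by (auto simp: X')
    moreover have "(\<lambda>\<omega>. (\<omega>, \<xi> j \<omega>)) -` (X \<times> B) \<inter> space M = X \<inter> (\<xi> j -` B \<inter> space M)"
      by auto
    ultimately show "emeasure (distr M \<F> (\<lambda>\<omega>. \<omega>)) X * emeasure (distr M D (\<xi> j)) B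
        = emeasure (distr M (\<F> \<Otimes>\<^sub>M D) (\<lambda>\<omega>. (\<omega>, \<xi> j \<omega>))) (X \<times> B)"
      using X by (simp add: emeasure_distr emeasure_eq_measure X'(2)[symmetric] ennreal_mult)
  qed (simp_all add: F.sigma_finite_measure_axioms E.sigma_finite_measure_axioms cong: sets_pair_measure_cong)
  have k': "k \<in> borel_measurable (distr M \<F> (\<lambda>\<omega>. \<omega>) \<Otimes>\<^sub>M distr M D (\<xi> j))" by simp
  have "(\<integral>\<^sup>+ \<omega>. k (\<omega>, \<xi> j \<omega>) \<partial>M) = integral\<^sup>N (distr M (\<F> \<Otimes>\<^sub>M D) (\<lambda>\<omega>. (\<omega>, \<xi> j \<omega>))) k"
    by (simp add: nn_integral_distr)
  also have "\<dots> = (\<integral>\<^sup>+ \<omega>. \<integral>\<^sup>+ s. k (\<omega>, s) \<partial>distr M D (\<xi> j) \<partial>distr M \<F> (\<lambda>\<omega>. \<omega>))"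
    unfolding eq[symmetric] by (rule E.nn_integral_fst[OF k', symmetric])
  also have "\<dots> = (\<integral>\<^sup>+ \<omega>. \<integral>\<^sup>+ s. k (\<omega>, s) \<partial>distr M D (\<xi> j) \<partial>M)"
    by (rule nn_integral_distr) (auto intro!: E.borel_measurable_nn_integral_fst)
  finally show ?thesis .
qed

section \<open>Step sizes and the Lyapunov function\<close>

text \<open>Factoring the difference of cubes gives \<open>u - v\<close> as the reciprocal of
  \<open>u\<^sup>2 + u * v + v\<^sup>2\<close>, a sum which is at least \<open>k * u\<close>. For
  the step sizes this bounds the growth of \<open>1 / \<mu> t\<close>.\<close>

lemma cube_root_step_le:
  fixes u v k :: real
  assumes "0 < k" "k \<le> u" "0 \<le> v" "v \<le> u" "u ^ 3 = v ^ 3 + 1"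
  shows "u / k - v / k \<le> 1 / (k\<^sup>2 * u)"
proof -
  have "k * u * (u - v) \<le> (u\<^sup>2 + u * v + v\<^sup>2) * (u - v)"
  proof (rule mult_right_mono)
    have "k * u \<le> u * u" using assms by (intro mult_right_mono) auto
    also have "\<dots> \<le> u\<^sup>2 + u * v + v\<^sup>2" using assms by (simp add: power2_eq_square)
    finally show "k * u \<le> u\<^sup>2 + u * v + v\<^sup>2" .
  qed (use assms in auto)
  also have "\<dots> = u ^ 3 - v ^ 3" by (simp add: algebra_simps power2_eq_square power3_eq_cube)
  finally have "k * u * (u - v) \<le> 1" using assms by simp
  then have "(k * u * (u - v)) / (k\<^sup>2 * u) \<le> 1 / (k\<^sup>2 * u)"
    using assms by (intro divide_right_mono) auto
  also have "(k * u * (u - v)) / (k\<^sup>2 * u) = u / k - v / k"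
    using assms by (simp add: diff_divide_distrib power2_eq_square)
  finally show ?thesis .
qed

lemma powr_third_cubed: "0 \<le> x \<Longrightarrow> (x powr (1 / 3)) ^ 3 = (x::real)"
  by (cases "x = 0") (simp_all add: powr_powr flip: powr_realpow)

lemma sum_inverse_le_ln:
  fixes m :: real
  assumes "1 \<le> m"
  shows "(\<Sum>i=1..n. 1 / (m + real i)) \<le> ln (m + real n)"
proof (induction n)
  case 0
  then show ?case using assms by simp
next
  case (Suc n)
  have "ln (m + real n) - ln (m + real (Suc n)) \<le> (m + real n - (m + real (Suc n))) / (m + real (Suc n))"
    using assms by (intro ln_diff_le) auto
  then have "1 / (m + real (Suc n)) \<le> ln (m + real (Suc n)) - ln (m + real n)"
    by simp
  with Suc show ?case by simp
qed

text \<open>This is the deterministic core, with the expectations replaced by plain sequences. The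
  weight of \<open>V t\<close> involves \<open>\<mu> (t - 1)\<close>, so the initial term carries
  \<open>\<mu> 0\<close> although the recursions start at 1.\<close>

lemma lyapunov_sum:
  fixes \<Phi> V \<Delta> \<mu> \<alpha> :: "nat \<Rightarrow> real" and \<rho> \<gamma> L \<sigma> c :: real
  assumes pos: "0 < \<rho>" "0 < \<gamma>" "0 < L" "\<And>t. 0 < \<mu> t"
    and nonneg: "\<And>t. 0 \<le> V t" "\<And>t. 0 \<le> \<Delta> t"
    and \<alpha>: "\<And>t. 1 \<le> t \<Longrightarrow> \<alpha> (t + 1) = c * (\<mu> t)\<^sup>2" "\<And>t. 1 \<le> t \<Longrightarrow> \<alpha> (t + 1) \<in> {0<..1}"
    and drift: "\<And>t. 1 \<le> t \<Longrightarrow>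
      (1 - \<alpha> (t + 1))\<^sup>2 / \<mu> t + 10 * L\<^sup>2 * \<gamma>\<^sup>2 / \<rho>\<^sup>2 * \<mu> t \<le> 1 / \<mu> (t - 1)"
    and descent: "\<And>t. 1 \<le> t \<Longrightarrow>
      \<Phi> (t + 1) + \<rho> * \<mu> t / (2 * \<gamma>) * \<Delta> t \<le> \<Phi> t + \<gamma> * \<mu> t / \<rho> * V t"
    and var: "\<And>t. 1 \<le> t \<Longrightarrow> V (t + 1) \<le> (1 - \<alpha> (t + 1))\<^sup>2 * V t
      + 2 * (\<alpha> (t + 1))\<^sup>2 * \<sigma>\<^sup>2 + 2 * (1 - \<alpha> (t + 1))\<^sup>2 * (L\<^sup>2 * (\<mu> t)\<^sup>2 * \<Delta> t)"
  shows "\<Phi> (n + 1) + \<rho> / (8 * \<gamma> * L\<^sup>2 * \<mu> n) * V (n + 1)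
      + (\<Sum>t=1..n. \<mu> t * (\<rho> / (4 * \<gamma>) * \<Delta> t + \<gamma> / (4 * \<rho>) * V t))
    \<le> \<Phi> 1 + \<rho> / (8 * \<gamma> * L\<^sup>2 * \<mu> 0) * V 1
      + (\<Sum>t=1..n. \<rho> * c\<^sup>2 * \<sigma>\<^sup>2 / (4 * \<gamma> * L\<^sup>2) * (\<mu> t) ^ 3)"
proof (induction n)
  case (Suc n)
  define t where "t = Suc n"
  define q where "q = \<rho> / (8 * \<gamma> * L\<^sup>2)"
  define a where "a = 1 - \<alpha> (t + 1)"
  have t: "1 \<le> t" "t - 1 = n" "t + 1 = Suc n + 1" by (auto simp: t_def)
  have q: "0 < q" using pos by (simp add: q_def)
  have a: "0 \<le> a" "a \<le> 1" using \<alpha>(2)[OF t(1)] by (auto simp: a_def)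
  then have a2: "a\<^sup>2 \<le> 1" by (simp add: power_le_one)
  note p = pos(4)[of t]
  have dr: "a\<^sup>2 / \<mu> t \<le> 1 / \<mu> n - 10 * L\<^sup>2 * \<gamma>\<^sup>2 / \<rho>\<^sup>2 * \<mu> t"
    using drift[OF t(1)] unfolding a_def t(2) by linarith
  have "q / \<mu> t * V (t + 1) \<le> q / \<mu> t * (a\<^sup>2 * V t + 2 * (\<alpha> (t + 1))\<^sup>2 * \<sigma>\<^sup>2 + 2 * a\<^sup>2 * (L\<^sup>2 * (\<mu> t)\<^sup>2 * \<Delta> t))"
    using var[OF t(1)] q p by (intro mult_left_mono) (auto simp: a_def)
  also have "\<dots> = q * (a\<^sup>2 / \<mu> t) * V t + 2 * q * c\<^sup>2 * \<sigma>\<^sup>2 * (\<mu> t) ^ 3 + a\<^sup>2 * (2 * q * L\<^sup>2 * \<mu> t * \<Delta> t)"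
    using p \<alpha>(1)[OF t(1)] by (simp add: field_simps power2_eq_square power3_eq_cube)
  \<comment> \<open>The drift condition is spent on the \<open>V\<close> term; in the
    \<open>\<Delta>\<close> term the factor \<open>a\<^sup>2\<close> is bounded by 1.\<close>
  also have "\<dots> \<le> q * (1 / \<mu> n - 10 * L\<^sup>2 * \<gamma>\<^sup>2 / \<rho>\<^sup>2 * \<mu> t) * V t
      + 2 * q * c\<^sup>2 * \<sigma>\<^sup>2 * (\<mu> t) ^ 3 + 1 * (2 * q * L\<^sup>2 * \<mu> t * \<Delta> t)"
    using dr q p nonneg a2
    by (intro add_mono mult_right_mono mult_left_mono) auto
  also have "\<dots> = q / \<mu> n * V t - 5 * \<gamma> / (4 * \<rho>) * \<mu> t * V t
      + \<rho> * c\<^sup>2 * \<sigma>\<^sup>2 / (4 * \<gamma> * L\<^sup>2) * (\<mu> t) ^ 3 + \<rho> / (4 * \<gamma>) * \<mu> t * \<Delta> t"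
  proof -
    have 1: "q * (10 * L\<^sup>2 * \<gamma>\<^sup>2 / \<rho>\<^sup>2) = 5 * \<gamma> / (4 * \<rho>)"
      using pos by (simp add: q_def field_simps power2_eq_square)
    have 2: "2 * q * c\<^sup>2 * \<sigma>\<^sup>2 = \<rho> * c\<^sup>2 * \<sigma>\<^sup>2 / (4 * \<gamma> * L\<^sup>2)"
      using pos by (simp add: q_def)
    have 3: "2 * q * L\<^sup>2 = \<rho> / (4 * \<gamma>)"
      using pos by (simp add: q_def)
    have "q * (1 / \<mu> n - 10 * L\<^sup>2 * \<gamma>\<^sup>2 / \<rho>\<^sup>2 * \<mu> t) * V t
        = q / \<mu> n * V t - q * (10 * L\<^sup>2 * \<gamma>\<^sup>2 / \<rho>\<^sup>2) * \<mu> t * V t"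
      by (simp add: left_diff_distrib right_diff_distrib)
    then show ?thesis by (simp only: 1 2 3 mult_1)
  qed
  finally have "q / \<mu> t * V (t + 1) \<le> q / \<mu> n * V t - 5 * \<gamma> / (4 * \<rho>) * \<mu> t * V t
      + \<rho> * c\<^sup>2 * \<sigma>\<^sup>2 / (4 * \<gamma> * L\<^sup>2) * (\<mu> t) ^ 3 + \<rho> / (4 * \<gamma>) * \<mu> t * \<Delta> t" .
  moreover have "\<mu> t * (\<rho> / (4 * \<gamma>) * \<Delta> t + \<gamma> / (4 * \<rho>) * V t)
      = (\<rho> / (4 * \<gamma>) * \<mu> t * \<Delta> t) + \<gamma> / (4 * \<rho>) * \<mu> t * V t"
    by (simp add: algebra_simps)
  \<comment> \<open>In common units, the \<open>\<Delta>\<close> terms have gain 2 against cost 1,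
    and the \<open>V\<close> terms have gain 5 against cost 4. One unit of each is left over, which
    is the summand on the left of the claim.\<close>
  moreover have "\<rho> * \<mu> t / (2 * \<gamma>) * \<Delta> t = 2 * (\<rho> / (4 * \<gamma>) * \<mu> t * \<Delta> t)"
    "\<gamma> * \<mu> t / \<rho> * V t = 4 * (\<gamma> / (4 * \<rho>) * \<mu> t * V t)"
    "5 * \<gamma> / (4 * \<rho>) * \<mu> t * V t = 5 * (\<gamma> / (4 * \<rho>) * \<mu> t * V t)"
    by simp_all
  moreover note descent[OF t(1)]
  ultimately have "\<Phi> (t + 1) + q / \<mu> t * V (t + 1) + \<mu> t * (\<rho> / (4 * \<gamma>) * \<Delta> t + \<gamma> / (4 * \<rho>) * V t)
      \<le> \<Phi> t + q / \<mu> n * V t + \<rho> * c\<^sup>2 * \<sigma>\<^sup>2 / (4 * \<gamma> * L\<^sup>2) * (\<mu> t) ^ 3"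
    by linarith
  then show ?case
    using Suc.IH by (simp add: t_def q_def)
qed simp

section \<open>Cauchy-Schwarz inequality with possibly infinite moments\<close>

text \<open>Young's inequality with one constant weight \<kappa> for all indices and outcomes is
  integrated and summed, and \<kappa> is then optimal for the totals. An infinite second moment of
  \<open>a\<close> makes the right-hand side infinite, since \<open>B\<close> is positive.\<close>

lemma nn_integral_mean_le_Cauchy_Schwarz:
  fixes u a z :: "nat \<Rightarrow> 'a \<Rightarrow> real"
  assumes [measurable]: "\<And>t. t \<in> I \<Longrightarrow> a t \<in> borel_measurable M" "\<And>t. t \<in> I \<Longrightarrow> z t \<in> borel_measurable M"
    and le: "\<And>t \<omega>. t \<in> I \<Longrightarrow> \<omega> \<in> space M \<Longrightarrow> u t \<omega> \<le> a t \<omega> * z t \<omega>"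
    and z: "(\<Sum>t\<in>I. \<integral>\<^sup>+ \<omega>. ennreal ((z t \<omega>)\<^sup>2) \<partial>M) \<le> ennreal (real N * B\<^sup>2)"
    and pos: "0 < B" "0 < N" "(\<Sum>t\<in>I. \<integral>\<^sup>+ \<omega>. ennreal ((a t \<omega>)\<^sup>2) \<partial>M) \<noteq> 0"
  shows "1 / of_nat N * (\<Sum>t\<in>I. \<integral>\<^sup>+ \<omega>. ennreal (u t \<omega>) \<partial>M)
    \<le> ennreal_sqrt (1 / of_nat N * (\<Sum>t\<in>I. \<integral>\<^sup>+ \<omega>. ennreal ((a t \<omega>)\<^sup>2) \<partial>M)) * ennreal B"
proof -
  let ?S = "\<Sum>t\<in>I. \<integral>\<^sup>+ \<omega>. ennreal ((a t \<omega>)\<^sup>2) \<partial>M"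
  let ?Q = "\<Sum>t\<in>I. \<integral>\<^sup>+ \<omega>. ennreal ((z t \<omega>)\<^sup>2) \<partial>M"
  have N: "1 / of_nat N = ennreal (1 / real N)"
    using pos by (simp add: ennreal_of_nat_eq_real_of_nat divide_ennreal flip: ennreal_1)
  show ?thesis
  proof (cases "?S = \<infinity>")
    case True
    then have "ennreal_sqrt (1 / of_nat N * ?S) * ennreal B = \<infinity>"
      using pos by (simp add: N ennreal_sqrt_def ennreal_mult_top ennreal_top_mult)
    then show ?thesis by simp
  next
    case False
    then obtain S where S: "?S = ennreal S" "0 \<le> S"
      by (cases ?S) auto
    with pos have S0: "0 < S" by (cases "S = 0") auto
    \<comment> \<open>This weight balances the two halves of Young's bound: each becomes half of
      \<open>sqrt (real N) * sqrt S * B\<close>.\<close>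
    define \<kappa> where "\<kappa> = sqrt (real N) * B / sqrt S"
    have \<kappa>: "0 < \<kappa>" using pos S0 by (simp add: \<kappa>_def)
    have "ennreal (u t \<omega>) \<le> ennreal (\<kappa> / 2) * ennreal ((a t \<omega>)\<^sup>2) + ennreal (1 / (2 * \<kappa>)) * ennreal ((z t \<omega>)\<^sup>2)"
      if "t \<in> I" "\<omega> \<in> space M" for t \<omega>
    proof -
      have "u t \<omega> \<le> a t \<omega> * z t \<omega>" using le that .
      also have "\<dots> \<le> \<kappa> / 2 * (a t \<omega>)\<^sup>2 + 1 / (2 * \<kappa>) * (z t \<omega>)\<^sup>2"
      proof -
        have "0 \<le> (\<kappa> * a t \<omega> - z t \<omega>)\<^sup>2" by simp
        then have "2 * \<kappa> * (a t \<omega> * z t \<omega>) \<le> \<kappa>\<^sup>2 * (a t \<omega>)\<^sup>2 + (z t \<omega>)\<^sup>2"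
          by (simp add: power2_diff power_mult_distrib algebra_simps)
        then show ?thesis using \<kappa> by (simp add: field_simps power2_eq_square)
      qed
      finally show ?thesis
        using \<kappa> by (simp flip: ennreal_mult ennreal_plus)
    qed
    then have "(\<Sum>t\<in>I. \<integral>\<^sup>+ \<omega>. ennreal (u t \<omega>) \<partial>M)
      \<le> (\<Sum>t\<in>I. \<integral>\<^sup>+ \<omega>. ennreal (\<kappa> / 2) * ennreal ((a t \<omega>)\<^sup>2) + ennreal (1 / (2 * \<kappa>)) * ennreal ((z t \<omega>)\<^sup>2) \<partial>M)"
      by (intro sum_mono nn_integral_mono) auto
    also have "\<dots> = (\<Sum>t\<in>I. ennreal (\<kappa> / 2) * (\<integral>\<^sup>+ \<omega>. ennreal ((a t \<omega>)\<^sup>2) \<partial>M)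
        + ennreal (1 / (2 * \<kappa>)) * (\<integral>\<^sup>+ \<omega>. ennreal ((z t \<omega>)\<^sup>2) \<partial>M))"
      by (intro sum.cong refl) (simp add: nn_integral_add nn_integral_cmult)
    also have "\<dots> = ennreal (\<kappa> / 2) * ?S + ennreal (1 / (2 * \<kappa>)) * ?Q"
      by (simp add: sum.distrib sum_distrib_left)
    also have "\<dots> \<le> ennreal (\<kappa> / 2) * ennreal S + ennreal (1 / (2 * \<kappa>)) * ennreal (real N * B\<^sup>2)"
      using z S by (intro add_mono mult_left_mono) auto
    also have "\<dots> = ennreal (\<kappa> / 2 * S + 1 / (2 * \<kappa>) * (real N * B\<^sup>2))"
      using \<kappa> S0 by (simp flip: ennreal_mult ennreal_plus)
    also have "\<kappa> / 2 * S + 1 / (2 * \<kappa>) * (real N * B\<^sup>2) = sqrt (real N) * sqrt S * B"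
    proof -
      define r s where "r = sqrt (real N)" and "s = sqrt S"
      have "r \<noteq> 0" "s \<noteq> 0" "real N = r\<^sup>2" "S = s\<^sup>2" using pos S0 by (auto simp: r_def s_def)
      then show ?thesis using pos S0
        unfolding \<kappa>_def r_def[symmetric] s_def[symmetric] by (simp add: field_simps power2_eq_square)
    qed
    finally have "1 / of_nat N * (\<Sum>t\<in>I. \<integral>\<^sup>+ \<omega>. ennreal (u t \<omega>) \<partial>M)
        \<le> ennreal (1 / real N) * ennreal (sqrt (real N) * sqrt S * B)"
      unfolding N by (intro mult_left_mono) auto
    also have "\<dots> = ennreal (sqrt (1 / real N * S) * B)"
      using pos S0 by (simp add: real_sqrt_divide real_div_sqrt field_simps flip: ennreal_mult)
    also have "\<dots> = ennreal_sqrt (1 / of_nat N * ?S) * ennreal B"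
      using S0 pos by (simp add: N S ennreal_sqrt_def flip: ennreal_mult)
    finally show ?thesis .
  qed
qed

section \<open>The random iterates\<close>

text \<open>The concrete step-size schedule stays outside. What the one-step estimates require of it
  is the cap \<open>\<mu>_le\<close>, which lets the curvature term of the descent lemma be absorbed
  by the decrease.\<close>

locale super_adam_run =
  fixes M :: "'a measure" and D :: "'b measure"
    and F :: "real ^ 'n \<Rightarrow> 'b \<Rightarrow> real" and f :: "real ^ 'n \<Rightarrow> real"
    and \<mu> \<alpha> :: "nat \<Rightarrow> real" and x\<^sub>1 :: "real ^ 'n"
    and \<xi> :: "nat \<Rightarrow> 'a \<Rightarrow> 'b" and H :: "nat \<Rightarrow> 'a \<Rightarrow> real ^ 'n ^ 'n"
    and xt x g :: "nat \<Rightarrow> 'a \<Rightarrow> real ^ 'n"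
    and \<gamma> \<sigma> \<rho> L fmin :: real
  assumes run: "super_adam M D F UNIV 1 \<gamma> \<mu> \<alpha> x\<^sub>1 \<xi> H xt x g"
    and f_diff: "\<And>y. f differentiable (at y)"
    and unbiased: "\<And>y. has_bochner_integral D (\<lambda>s. grad (\<lambda>z. F z s) y) (grad f y)"
    and variance: "\<And>y. (\<integral>\<^sup>+ s. ennreal ((norm (grad (\<lambda>z. F z s) y - grad f y))\<^sup>2) \<partial>D)
                          \<le> ennreal (\<sigma>\<^sup>2)"
    and fmin: "\<And>y. fmin \<le> f y"
    and \<rho>: "\<rho> > 0"
    and H_ge: "\<And>t \<omega>. t \<ge> 1 \<Longrightarrow> \<omega> \<in> space M \<Longrightarrow> loewner_le (\<rho> *\<^sub>R mat 1) (H t \<omega>)"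
    and L: "L > 0"
    and lipschitz: "\<And>s y z. s \<in> space D \<Longrightarrow>
          norm (grad (\<lambda>w. F w s) y - grad (\<lambda>w. F w s) z) \<le> L * norm (y - z)"
    and \<mu>_le: "\<And>t. t \<ge> 1 \<Longrightarrow> \<mu> t \<le> \<rho> / (2 * L * \<gamma>)"
begin

definition h :: "real ^ 'n \<Rightarrow> 'b \<Rightarrow> real ^ 'n" where
  "h y s = grad (\<lambda>z. F z s) y"

definition d :: "nat \<Rightarrow> 'a \<Rightarrow> real ^ 'n" where
  "d t \<omega> = xt (t + 1) \<omega> - x t \<omega>"

definition e :: "nat \<Rightarrow> 'a \<Rightarrow> real ^ 'n" where
  "e t \<omega> = grad f (x t \<omega>) - g t \<omega>"

text \<open>The history is a sigma-algebra on the space of \<open>M\<close> generated by the sample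
  tuple, the form that \<open>nn_integral_fresh_sample\<close> expects.\<close>

definition \<F> :: "nat \<Rightarrow> 'a measure" where
  "\<F> t = vimage_algebra (space M) (\<lambda>\<omega>. \<lambda>i\<in>{1..t}. \<xi> i \<omega>) (\<Pi>\<^sub>M i\<in>{1..t}. D)"

sublocale M: prob_space M using run by (simp add: super_adam_def)
sublocale D: prob_space D using run by (simp add: super_adam_def)

lemma \<gamma>: "0 < \<gamma>"
  using run by (simp add: super_adam_def)

lemma \<mu>_pos: "1 \<le> t \<Longrightarrow> 0 < \<mu> t"
  using run by (simp add: super_adam_def)

lemma \<alpha>: "1 \<le> t \<Longrightarrow> \<alpha> (t + 1) \<in> {0<..1}"
  using run by (simp add: super_adam_def)

lemma indep: "M.indep_vars (\<lambda>_. D) \<xi> {1..}"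
  using run by (simp add: super_adam_def)

lemma distr_\<xi>: "1 \<le> t \<Longrightarrow> distr M D (\<xi> t) = D"
  using run by (simp add: super_adam_def)

lemma init: "\<omega> \<in> space M \<Longrightarrow> x 1 \<omega> = x\<^sub>1" "\<omega> \<in> space M \<Longrightarrow> g 1 \<omega> = h x\<^sub>1 (\<xi> 1 \<omega>)"
  using run by (simp_all add: super_adam_def h_def)

lemma
  assumes "1 \<le> t" "\<omega> \<in> space M"
  shows x_step: "x (t + 1) \<omega> = x t \<omega> + \<mu> t *\<^sub>R d t \<omega>"
    and g_step: "g (t + 1) \<omega> = \<alpha> (t + 1) *\<^sub>R h (x (t + 1) \<omega>) (\<xi> (t + 1) \<omega>) +
      (1 - \<alpha> (t + 1)) *\<^sub>R (g t \<omega> + (h (x (t + 1) \<omega>) (\<xi> (t + 1) \<omega>) - h (x t \<omega>) (\<xi> (t + 1) \<omega>)))"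
    and first_order: "H t \<omega> *v d t \<omega> = - \<gamma> *\<^sub>R g t \<omega>"
proof -
  have r: "transpose (H t \<omega>) = H t \<omega>"
    "is_arg_min (\<lambda>y. g t \<omega> \<bullet> y + 1 / (2 * \<gamma>) * ((y - x t \<omega>) \<bullet> (H t \<omega> *v (y - x t \<omega>))))
       (\<lambda>y. y \<in> UNIV) (xt (t + 1) \<omega>)"
    "x (t + 1) \<omega> = (1 - \<mu> t) *\<^sub>R x t \<omega> + \<mu> t *\<^sub>R xt (t + 1) \<omega>"
    "g (t + 1) \<omega> = \<alpha> (t + 1) *\<^sub>R grad (\<lambda>y. F y (\<xi> (t + 1) \<omega>)) (x (t + 1) \<omega>) +
      (1 - \<alpha> (t + 1)) *\<^sub>R (g t \<omega> + 1 *\<^sub>R (grad (\<lambda>y. F y (\<xi> (t + 1) \<omega>)) (x (t + 1) \<omega>) -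
         grad (\<lambda>y. F y (\<xi> (t + 1) \<omega>)) (x t \<omega>)))"
    using run assms unfolding super_adam_def by blast+
  show "x (t + 1) \<omega> = x t \<omega> + \<mu> t *\<^sub>R d t \<omega>"
    unfolding r(3) by (simp add: d_def algebra_simps)
  show "g (t + 1) \<omega> = \<alpha> (t + 1) *\<^sub>R h (x (t + 1) \<omega>) (\<xi> (t + 1) \<omega>) +
      (1 - \<alpha> (t + 1)) *\<^sub>R (g t \<omega> + (h (x (t + 1) \<omega>) (\<xi> (t + 1) \<omega>) - h (x t \<omega>) (\<xi> (t + 1) \<omega>)))"
    using r(4) by (simp add: h_def)
  have "\<gamma> *\<^sub>R (g t \<omega> + (1 / \<gamma>) *\<^sub>R (H t \<omega> *v d t \<omega>)) = 0"
    using quadratic_arg_min_gradient[OF r(1,2)] \<gamma> by (simp add: d_def)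
  then show "H t \<omega> *v d t \<omega> = - \<gamma> *\<^sub>R g t \<omega>"
    using \<gamma> by (simp add: scaleR_add_right add_eq_0_iff)
qed

section \<open>Regularity of the objective and of the sample gradients\<close>

text \<open>The true gradient is the mean of the sample gradients, and the norm of a mean is at most
  the mean of the norms.\<close>

lemma grad_lipschitz: "norm (grad f y - grad f z) \<le> L * norm (y - z)"
proof -
  have i: "has_bochner_integral D (\<lambda>s. h y s - h z s) (grad f y - grad f z)"
    unfolding h_def by (intro has_bochner_integral_diff unbiased)
  then have "norm (grad f y - grad f z) \<le> (\<integral>s. norm (h y s - h z s) \<partial>D)"
    using integral_norm_bound[of D "\<lambda>s. h y s - h z s"] by (simp add: has_bochner_integral_iff)
  also have "\<dots> \<le> L * norm (y - z)"
    using i lipschitz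
    by (intro D.integral_le_const) (auto simp: has_bochner_integral_iff h_def intro!: AE_I2)
  finally show ?thesis .
qed

lemma grad_f_measurable [measurable]: "grad f \<in> borel_measurable borel"
  by (intro borel_measurable_continuous_onI lipschitz_on_continuous_on[of L] lipschitz_onI)
     (use L grad_lipschitz in \<open>auto simp: dist_norm\<close>)

lemma f_measurable [measurable]: "f \<in> borel_measurable borel"
  by (intro borel_measurable_continuous_onI differentiable_imp_continuous_on)
     (simp add: differentiable_on_def f_diff)

lemma h_measurable [measurable]: "(\<lambda>(y, s). h y s) \<in> borel_measurable (borel \<Otimes>\<^sub>M D)"
proof (rule borel_measurable_Caratheodory)
  show "h y \<in> borel_measurable D" for y
    using unbiased[of y] unfolding h_def by (rule borel_measurable_has_bochner_integral)
  show "continuous_on UNIV (\<lambda>y. h y s)" if "s \<in> space D" for s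
    by (intro lipschitz_on_continuous_on[of L] lipschitz_onI)
       (use L lipschitz that in \<open>auto simp: dist_norm h_def\<close>)
qed

section \<open>The filtration of the samples and adaptedness of the iterates\<close>

lemma \<xi>_measurable: "1 \<le> t \<Longrightarrow> \<xi> t \<in> M \<rightarrow>\<^sub>M D"
  using indep by (auto simp: M.indep_vars_def)

lemma samples_measurable: "(\<lambda>\<omega>. \<lambda>i\<in>{1..t}. \<xi> i \<omega>) \<in> M \<rightarrow>\<^sub>M (\<Pi>\<^sub>M i\<in>{1..t}. D)"
  by (intro measurable_restrict \<xi>_measurable) auto

lemma samples_space: "(\<lambda>\<omega>. \<lambda>i\<in>{1..t}. \<xi> i \<omega>) \<in> space M \<rightarrow> space (\<Pi>\<^sub>M i\<in>{1..t}. D)"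
  using samples_measurable by (auto dest: measurable_space)

lemma space_\<F> [simp]: "space (\<F> t) = space M"
  by (simp add: \<F>_def)

lemma samples_\<F>: "(\<lambda>\<omega>. \<lambda>i\<in>{1..t}. \<xi> i \<omega>) \<in> \<F> t \<rightarrow>\<^sub>M (\<Pi>\<^sub>M i\<in>{1..t}. D)"
  unfolding \<F>_def using samples_space by (rule measurable_vimage_algebra1)

lemma \<xi>_\<F>: "1 \<le> t \<Longrightarrow> \<xi> t \<in> \<F> t \<rightarrow>\<^sub>M D"
  using measurable_compose[OF samples_\<F> measurable_component_singleton, of t t] by simp

lemma measurable_\<F>_M:
  assumes "u \<in> \<F> t \<rightarrow>\<^sub>M N"
  shows "u \<in> M \<rightarrow>\<^sub>M N"
proof -
  have "(\<lambda>\<omega>. \<omega>) \<in> M \<rightarrow>\<^sub>M \<F> t"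
    unfolding \<F>_def by (intro measurable_vimage_algebra2 samples_measurable) auto
  from measurable_compose[OF this assms] show ?thesis .
qed

lemma measurable_\<F>_Suc:
  assumes "u \<in> \<F> t \<rightarrow>\<^sub>M N"
  shows "u \<in> \<F> (t + 1) \<rightarrow>\<^sub>M N"
proof -
  \<comment> \<open>The shorter tuple is a restriction of the longer one; hence the identity is
    measurable from the later to the earlier sigma-algebra.\<close>
  have "(\<lambda>\<omega>. restrict (\<lambda>i\<in>{1..t+1}. \<xi> i \<omega>) {1..t}) \<in> \<F> (t + 1) \<rightarrow>\<^sub>M (\<Pi>\<^sub>M i\<in>{1..t}. D)"
    by (rule measurable_compose[OF samples_\<F>]) (rule measurable_restrict_subset, auto)
  also have "(\<lambda>\<omega>. restrict (\<lambda>i\<in>{1..t+1}. \<xi> i \<omega>) {1..t}) = (\<lambda>\<omega>. \<lambda>i\<in>{1..t}. \<xi> i \<omega>)"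
    by (auto simp: restrict_def fun_eq_iff)
  finally have "(\<lambda>\<omega>. \<omega>) \<in> \<F> (t + 1) \<rightarrow>\<^sub>M \<F> t"
    unfolding \<F>_def[of t] by (intro measurable_vimage_algebra2) (simp, assumption)
  from measurable_compose[OF this assms] show ?thesis .
qed

lemma borel_measurable_\<F>_cong:
  assumes "u \<in> borel_measurable (\<F> t)" "\<And>\<omega>. \<omega> \<in> space M \<Longrightarrow> v \<omega> = u \<omega>"
  shows "v \<in> borel_measurable (\<F> t)"
  using assms by (subst measurable_cong[where g = u]) simp_all

lemma H_\<F>:
  assumes "1 \<le> t"
  shows "H t \<in> borel_measurable (\<F> t)"
proof -
  obtain R where R: "R \<in> borel_measurable (\<Pi>\<^sub>M i\<in>{1..t}. D)"
      "\<And>\<omega>. \<omega> \<in> space M \<Longrightarrow> H t \<omega> = R (\<lambda>i\<in>{1..t}. \<xi> i \<omega>)"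
    using run assms unfolding super_adam_def by blast
  show ?thesis
    by (rule borel_measurable_\<F>_cong[OF measurable_compose[OF samples_\<F> R(1)] R(2)])
qed

text \<open>The algorithm specifies the minimizer only as an arg min, with no measurable selection.
  Measurability follows because the first-order equation with invertible \<open>H t\<close>
  determines the step.\<close>

lemma d_\<F>:
  assumes "1 \<le> t" and [measurable]: "g t \<in> borel_measurable (\<F> t)"
  shows "d t \<in> borel_measurable (\<F> t)"
proof (rule borel_measurable_linear_solution)
  show "H t \<in> borel_measurable (\<F> t)" using assms(1) by (rule H_\<F>)
  show "(\<lambda>\<omega>. - \<gamma> *\<^sub>R g t \<omega>) \<in> borel_measurable (\<F> t)" by measurable
qed (use assms(1) first_order loewner_ge_det_neq_0[OF H_ge \<rho>] in auto)

text \<open>The next iterate is known one step ahead, before \<open>\<xi> (t + 1)\<close> is drawn.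
  This makes that sample fresh relative to both points where its gradient is evaluated.\<close>

lemma x_Suc_\<F>:
  assumes "1 \<le> t" and [measurable]: "x t \<in> borel_measurable (\<F> t)" "g t \<in> borel_measurable (\<F> t)"
  shows "x (t + 1) \<in> borel_measurable (\<F> t)"
proof -
  note [measurable] = d_\<F>[OF assms(1,3)]
  have "(\<lambda>\<omega>. x t \<omega> + \<mu> t *\<^sub>R d t \<omega>) \<in> borel_measurable (\<F> t)" by measurable
  then show ?thesis using x_step[OF assms(1)] by (rule borel_measurable_\<F>_cong)
qed

lemma x_g_\<F>:
  assumes "1 \<le> t"
  shows "x t \<in> borel_measurable (\<F> t) \<and> g t \<in> borel_measurable (\<F> t)"
  using assms
proof (induction t rule: nat_induct_at_least)
  case base
  note [measurable] = \<xi>_\<F>[OF order_refl]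
  have "(\<lambda>\<omega>. x\<^sub>1) \<in> borel_measurable (\<F> 1)" by simp
  moreover have "(\<lambda>\<omega>. h x\<^sub>1 (\<xi> 1 \<omega>)) \<in> borel_measurable (\<F> 1)" by measurable
  ultimately show ?case
    using init borel_measurable_\<F>_cong by blast
next
  case (Suc t)
  then have g: "g t \<in> borel_measurable (\<F> t)" and x: "x t \<in> borel_measurable (\<F> t)" by auto
  note [measurable] = measurable_\<F>_Suc[OF g] measurable_\<F>_Suc[OF x]
    measurable_\<F>_Suc[OF x_Suc_\<F>[OF \<open>1 \<le> t\<close> x g]] \<xi>_\<F>[OF le_add2[of 1 t]]
  have "(\<lambda>\<omega>. \<alpha> (t + 1) *\<^sub>R h (x (t + 1) \<omega>) (\<xi> (t + 1) \<omega>) +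
      (1 - \<alpha> (t + 1)) *\<^sub>R (g t \<omega> + (h (x (t + 1) \<omega>) (\<xi> (t + 1) \<omega>) - h (x t \<omega>) (\<xi> (t + 1) \<omega>))))
      \<in> borel_measurable (\<F> (t + 1))"
    by measurable
  then have "g (t + 1) \<in> borel_measurable (\<F> (t + 1))"
    using g_step[OF \<open>1 \<le> t\<close>] by (rule borel_measurable_\<F>_cong)
  then show ?case
    using measurable_\<F>_Suc[OF x_Suc_\<F>[OF \<open>1 \<le> t\<close> x g]] by simp
qed

lemma
  assumes "1 \<le> t"
  shows x_measurable: "x t \<in> borel_measurable M"
    and d_measurable: "d t \<in> borel_measurable M" and e_measurable: "e t \<in> borel_measurable M"
    and H_measurable: "H t \<in> borel_measurable M"
proof -
  show x [measurable]: "x t \<in> borel_measurable M"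
    using x_g_\<F>[OF assms] by (auto intro: measurable_\<F>_M)
  have g [measurable]: "g t \<in> borel_measurable M"
    using x_g_\<F>[OF assms] by (auto intro: measurable_\<F>_M)
  show "d t \<in> borel_measurable M"
    using x_g_\<F>[OF assms] d_\<F>[OF assms] by (auto intro: measurable_\<F>_M)
  show "e t \<in> borel_measurable M"
    unfolding e_def by measurable
  show "H t \<in> borel_measurable M"
    using H_\<F>[OF assms] by (rule measurable_\<F>_M)
qed

section \<open>One-step inequalities for the function value and the estimation error\<close>

lemma descent:
  assumes t: "1 \<le> t" and \<omega>: "\<omega> \<in> space M"
  shows "f (x (t + 1) \<omega>) + \<rho> * \<mu> t / (2 * \<gamma>) * (norm (d t \<omega>))\<^sup>2
    \<le> f (x t \<omega>) + \<gamma> * \<mu> t / \<rho> * (norm (e t \<omega>))\<^sup>2"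
proof -
  let ?d = "d t \<omega>" and ?e = "e t \<omega>" and ?g = "g t \<omega>"
  note \<mu> = \<mu>_pos[OF t]
  have "f (x (t + 1) \<omega>) \<le> f (x t \<omega>) + grad f (x t \<omega>) \<bullet> (\<mu> t *\<^sub>R ?d) + L / 2 * (norm (\<mu> t *\<^sub>R ?d))\<^sup>2"
    unfolding x_step[OF t \<omega>] using f_diff grad_lipschitz by (rule descent_lemma)
  also have "grad f (x t \<omega>) = ?g + ?e" by (simp add: e_def)
  also have "f (x t \<omega>) + (?g + ?e) \<bullet> (\<mu> t *\<^sub>R ?d) + L / 2 * (norm (\<mu> t *\<^sub>R ?d))\<^sup>2
      = f (x t \<omega>) + \<mu> t * (?g \<bullet> ?d + ?e \<bullet> ?d + L * \<mu> t / 2 * (norm ?d)\<^sup>2)"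
    by (simp add: inner_add_left power_mult_distrib algebra_simps power2_eq_square)
  also have "\<dots> \<le> f (x t \<omega>) + \<mu> t * (\<gamma> / \<rho> * (norm ?e)\<^sup>2 - \<rho> / (2 * \<gamma>) * (norm ?d)\<^sup>2)"
  proof -
    have "\<rho> * (norm ?d)\<^sup>2 \<le> ?d \<bullet> (H t \<omega> *v ?d)" by (rule loewner_geD[OF H_ge[OF t \<omega>]])
    also have "\<dots> = - \<gamma> * (?g \<bullet> ?d)" by (simp add: first_order[OF t \<omega>] inner_commute)
    finally have 1: "?g \<bullet> ?d \<le> - (\<rho> / \<gamma> * (norm ?d)\<^sup>2)"
      using \<gamma> by (simp add: field_simps)
    \<comment> \<open>The factor \<open>\<rho> / 2\<close> is chosen so that Young's inequality
      costs only \<open>\<rho> / (4 * \<gamma>)\<close> times the squared step, a quarter of the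
      decrease in fact \<open>1\<close>.\<close>
    have "0 \<le> (\<gamma> * norm ?e - \<rho> / 2 * norm ?d)\<^sup>2" by simp
    then have "\<gamma> * \<rho> * (norm ?e * norm ?d) \<le> \<gamma>\<^sup>2 * (norm ?e)\<^sup>2 + \<rho>\<^sup>2 / 4 * (norm ?d)\<^sup>2"
      by (simp add: power2_eq_square algebra_simps)
    moreover have "\<gamma> * \<rho> * (?e \<bullet> ?d) \<le> \<gamma> * \<rho> * (norm ?e * norm ?d)"
      using \<gamma> \<rho> by (intro mult_left_mono norm_cauchy_schwarz) auto
    ultimately have "\<gamma> * \<rho> * (?e \<bullet> ?d) \<le> \<gamma>\<^sup>2 * (norm ?e)\<^sup>2 + \<rho>\<^sup>2 / 4 * (norm ?d)\<^sup>2"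
      by simp
    then have "\<gamma> * \<rho> * (?e \<bullet> ?d) \<le> \<gamma>\<^sup>2 * (norm ?e)\<^sup>2 + \<rho>\<^sup>2 / 4 * (norm ?d)\<^sup>2"
      by (simp add: power2_norm_eq_inner inner_diff_left inner_diff_right inner_commute
          power2_eq_square algebra_simps)
    then have "\<gamma> * \<rho> * (?e \<bullet> ?d) / (\<gamma> * \<rho>) \<le> (\<gamma>\<^sup>2 * (norm ?e)\<^sup>2 + \<rho>\<^sup>2 / 4 * (norm ?d)\<^sup>2) / (\<gamma> * \<rho>)"
      using \<gamma> \<rho> by (intro divide_right_mono) auto
    then have 2: "?e \<bullet> ?d \<le> \<gamma> / \<rho> * (norm ?e)\<^sup>2 + \<rho> / (4 * \<gamma>) * (norm ?d)\<^sup>2"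
      using \<gamma> \<rho> by (simp add: add_divide_distrib power2_eq_square)
    have "L * \<mu> t / 2 \<le> L * (\<rho> / (2 * L * \<gamma>)) / 2"
      using \<mu>_le[OF t] L by (intro divide_right_mono mult_left_mono) auto
    also have "\<dots> = \<rho> / (4 * \<gamma>)" using L by simp
    finally have 3: "L * \<mu> t / 2 * (norm ?d)\<^sup>2 \<le> \<rho> / (4 * \<gamma>) * (norm ?d)\<^sup>2"
      by (intro mult_right_mono) auto
    \<comment> \<open>Of the four quarters of decrease, Young's inequality and the curvature term
      take one each; two remain.\<close>
    have "\<rho> / \<gamma> * (norm ?d)\<^sup>2 = 4 * (\<rho> / (4 * \<gamma>) * (norm ?d)\<^sup>2)"
      "\<rho> / (2 * \<gamma>) * (norm ?d)\<^sup>2 = 2 * (\<rho> / (4 * \<gamma>) * (norm ?d)\<^sup>2)" by simp_all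
    with 1 2 3 have "?g \<bullet> ?d + ?e \<bullet> ?d + L * \<mu> t / 2 * (norm ?d)\<^sup>2
        \<le> \<gamma> / \<rho> * (norm ?e)\<^sup>2 - \<rho> / (2 * \<gamma>) * (norm ?d)\<^sup>2" by linarith
    then show ?thesis using \<mu> by simp
  qed
  finally show ?thesis by (simp add: algebra_simps)
qed

text \<open>For fixed \<omega> the inner integral over the fresh sample falls under
  \<open>storm_variance_step\<close>. Nonnegative integrals are used because finiteness of the
  second moments is itself deduced from this bound later.\<close>

lemma variance_step:
  assumes t: "1 \<le> t"
  shows "(\<integral>\<^sup>+ \<omega>. ennreal ((norm (e (t + 1) \<omega>))\<^sup>2) \<partial>M) \<le>
    (\<integral>\<^sup>+ \<omega>. ennreal ((1 - \<alpha> (t + 1))\<^sup>2 * (norm (e t \<omega>))\<^sup>2 + 2 * (\<alpha> (t + 1))\<^sup>2 * \<sigma>\<^sup>2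
      + 2 * (1 - \<alpha> (t + 1))\<^sup>2 * (L * (\<mu> t * norm (d t \<omega>)))\<^sup>2) \<partial>M)"
proof -
  let ?a = "\<alpha> (t + 1)"
  define k where "k = (\<lambda>(\<omega>, s). ennreal ((norm (grad f (x (t + 1) \<omega>) - (?a *\<^sub>R h (x (t + 1) \<omega>) s
      + (1 - ?a) *\<^sub>R (g t \<omega> + (h (x (t + 1) \<omega>) s - h (x t \<omega>) s)))))\<^sup>2))"
  from x_g_\<F>[OF t] have x [measurable]: "x t \<in> borel_measurable (\<F> t)"
    and g [measurable]: "g t \<in> borel_measurable (\<F> t)" by auto
  note [measurable] = x_Suc_\<F>[OF t x g]
  have k: "k \<in> borel_measurable (\<F> t \<Otimes>\<^sub>M D)" unfolding k_def by measurable
  have "(\<integral>\<^sup>+ \<omega>. ennreal ((norm (e (t + 1) \<omega>))\<^sup>2) \<partial>M) = (\<integral>\<^sup>+ \<omega>. k (\<omega>, \<xi> (t + 1) \<omega>) \<partial>M)"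
    by (intro nn_integral_cong) (use g_step[OF t] in \<open>simp add: e_def k_def\<close>)
  also have "\<dots> = (\<integral>\<^sup>+ \<omega>. \<integral>\<^sup>+ s. k (\<omega>, s) \<partial>distr M D (\<xi> (t + 1)) \<partial>M)"
    by (rule M.nn_integral_fresh_sample[OF indep _ _ k[unfolded \<F>_def]]) auto
  also have "\<dots> = (\<integral>\<^sup>+ \<omega>. \<integral>\<^sup>+ s. k (\<omega>, s) \<partial>D \<partial>M)"
    by (simp only: distr_\<xi>[of "t + 1", simplified] Suc_eq_plus1[symmetric])
  also have "\<dots> \<le> (\<integral>\<^sup>+ \<omega>. ennreal ((1 - ?a)\<^sup>2 * (norm (e t \<omega>))\<^sup>2 + 2 * ?a\<^sup>2 * \<sigma>\<^sup>2
      + 2 * (1 - ?a)\<^sup>2 * (L * (\<mu> t * norm (d t \<omega>)))\<^sup>2) \<partial>M)"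
  proof (rule nn_integral_mono)
    fix \<omega> assume \<omega>: "\<omega> \<in> space M"
    show "(\<integral>\<^sup>+ s. k (\<omega>, s) \<partial>D) \<le> ennreal ((1 - ?a)\<^sup>2 * (norm (e t \<omega>))\<^sup>2 + 2 * ?a\<^sup>2 * \<sigma>\<^sup>2
      + 2 * (1 - ?a)\<^sup>2 * (L * (\<mu> t * norm (d t \<omega>)))\<^sup>2)"
      unfolding k_def e_def prod.case
    proof (rule D.storm_variance_step)
      \<comment> \<open>The constant \<open>K\<close> of the variance lemma may depend on \<omega>:
        consecutive iterates differ by \<open>\<mu> t *\<^sub>R d t \<omega>\<close>, which is fixed
        given the past.\<close>
      show "norm (h (x (t + 1) \<omega>) s - h (x t \<omega>) s) \<le> L * (\<mu> t * norm (d t \<omega>))" if "s \<in> space D" for s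
        using lipschitz[OF that, of "x (t + 1) \<omega>" "x t \<omega>"] x_step[OF t \<omega>] \<mu>_pos[OF t]
        by (simp add: h_def)
    qed (use unbiased variance in \<open>simp_all add: h_def\<close>)
  qed
  finally show ?thesis .
qed


text \<open>The start is deterministic and \<open>g 1\<close> is one sample gradient there, so
  \<open>e 1\<close> is pure sampling error.\<close>

lemma variance_init: "(\<integral>\<^sup>+ \<omega>. ennreal ((norm (e 1 \<omega>))\<^sup>2) \<partial>M) \<le> ennreal (\<sigma>\<^sup>2)"
proof -
  note \<xi>1 = \<xi>_measurable[OF order_refl]
  have [measurable]: "h x\<^sub>1 \<in> borel_measurable D"
    using unbiased[of x\<^sub>1] unfolding h_def by (rule borel_measurable_has_bochner_integral)
  have "(\<integral>\<^sup>+ \<omega>. ennreal ((norm (e 1 \<omega>))\<^sup>2) \<partial>M)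
      = (\<integral>\<^sup>+ \<omega>. ennreal ((norm (h x\<^sub>1 (\<xi> 1 \<omega>) - grad f x\<^sub>1))\<^sup>2) \<partial>M)"
    by (intro nn_integral_cong) (simp add: e_def init norm_minus_commute del: One_nat_def)
  also have "\<dots> = (\<integral>\<^sup>+ s. ennreal ((norm (h x\<^sub>1 s - grad f x\<^sub>1))\<^sup>2) \<partial>distr M D (\<xi> 1))"
    by (rule nn_integral_distr[OF \<xi>1, symmetric]) measurable
  also have "\<dots> \<le> ennreal (\<sigma>\<^sup>2)"
    unfolding distr_\<xi>[OF order_refl] using variance[of x\<^sub>1] by (simp add: h_def)
  finally show ?thesis .
qed

section \<open>Integrability along the run\<close>

text \<open>The descent inequality is solved for the squared step, with the next function value
  replaced by its lower bound \<open>fmin\<close>.\<close>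

lemma integrable_d:
  assumes t: "1 \<le> t" and f: "integrable M (\<lambda>\<omega>. f (x t \<omega>))" and e: "integrable M (\<lambda>\<omega>. (norm (e t \<omega>))\<^sup>2)"
  shows "integrable M (\<lambda>\<omega>. (norm (d t \<omega>))\<^sup>2)"
proof -
  note [measurable] = d_measurable[OF t]
  define C where "C = \<rho> * \<mu> t / (2 * \<gamma>)"
  have C: "0 < C" using \<rho> \<gamma> \<mu>_pos[OF t] by (simp add: C_def)
  have "integrable M (\<lambda>\<omega>. (f (x t \<omega>) - fmin + \<gamma> * \<mu> t / \<rho> * (norm (e t \<omega>))\<^sup>2) / C)"
    using f e by simp
  then show ?thesis
  proof (rule Bochner_Integration.integrable_bound)
    show "AE \<omega> in M. norm ((norm (d t \<omega>))\<^sup>2)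
        \<le> norm ((f (x t \<omega>) - fmin + \<gamma> * \<mu> t / \<rho> * (norm (e t \<omega>))\<^sup>2) / C)"
    proof (rule AE_I2)
      fix \<omega> assume "\<omega> \<in> space M"
      with descent[OF t this] fmin[of "x (t + 1) \<omega>"]
      have "(norm (d t \<omega>))\<^sup>2 * C \<le> f (x t \<omega>) - fmin + \<gamma> * \<mu> t / \<rho> * (norm (e t \<omega>))\<^sup>2"
        unfolding C_def[symmetric] mult.commute[of _ C] by linarith
      then have "(norm (d t \<omega>))\<^sup>2 \<le> (f (x t \<omega>) - fmin + \<gamma> * \<mu> t / \<rho> * (norm (e t \<omega>))\<^sup>2) / C"
        using C by (simp add: pos_le_divide_eq)
      then show "norm ((norm (d t \<omega>))\<^sup>2)
        \<le> norm ((f (x t \<omega>) - fmin + \<gamma> * \<mu> t / \<rho> * (norm (e t \<omega>))\<^sup>2) / C)"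
        unfolding real_norm_def abs_of_nonneg[OF zero_le_power2] by (rule order_trans[OF _ abs_ge_self])
    qed
  qed measurable
qed

lemma integrable_variance_bound:
  assumes t: "1 \<le> t" and f: "integrable M (\<lambda>\<omega>. f (x t \<omega>))" and e: "integrable M (\<lambda>\<omega>. (norm (e t \<omega>))\<^sup>2)"
  shows "integrable M (\<lambda>\<omega>. (1 - \<alpha> (t + 1))\<^sup>2 * (norm (e t \<omega>))\<^sup>2 + 2 * (\<alpha> (t + 1))\<^sup>2 * \<sigma>\<^sup>2
      + 2 * (1 - \<alpha> (t + 1))\<^sup>2 * (L * (\<mu> t * norm (d t \<omega>)))\<^sup>2)"
  using e integrable_d[OF assms] by (simp add: power_mult_distrib)

text \<open>Both claims are proved in one induction since each step needs both predecessors. The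
  function value is squeezed between \<open>fmin\<close> and the descent bound, and the error is
  controlled by \<open>variance_step\<close>.\<close>

lemma integrable_run:
  assumes "1 \<le> t"
  shows "integrable M (\<lambda>\<omega>. f (x t \<omega>)) \<and> integrable M (\<lambda>\<omega>. (norm (e t \<omega>))\<^sup>2)"
  using assms
proof (induction t rule: nat_induct_at_least)
  case base
  have "integrable M (\<lambda>\<omega>. f (x 1 \<omega>)) \<longleftrightarrow> integrable M (\<lambda>\<omega>. f x\<^sub>1)"
    by (intro Bochner_Integration.integrable_cong) (simp_all add: init del: One_nat_def)
  moreover note [measurable] = e_measurable[OF order_refl]
  have "integrable M (\<lambda>\<omega>. (norm (e 1 \<omega>))\<^sup>2)"
  proof (rule integrableI_bounded)
    show "(\<integral>\<^sup>+ \<omega>. ennreal (norm ((norm (e 1 \<omega>))\<^sup>2)) \<partial>M) < \<infinity>"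
      using variance_init by (simp add: order_le_less_trans)
  qed measurable
  ultimately show ?case by simp
next
  case (Suc t)
  then have f: "integrable M (\<lambda>\<omega>. f (x t \<omega>))" and e: "integrable M (\<lambda>\<omega>. (norm (e t \<omega>))\<^sup>2)" by auto
  note [measurable] = x_measurable[of "t + 1", OF le_add2] e_measurable[of "t + 1", OF le_add2]
  have "integrable M (\<lambda>\<omega>. \<bar>fmin\<bar> + \<bar>f (x t \<omega>) + \<gamma> * \<mu> t / \<rho> * (norm (e t \<omega>))\<^sup>2\<bar>)"
    using f e by simp
  then have "integrable M (\<lambda>\<omega>. f (x (t + 1) \<omega>))"
  proof (rule Bochner_Integration.integrable_bound)
    show "AE \<omega> in M. norm (f (x (t + 1) \<omega>))
        \<le> norm (\<bar>fmin\<bar> + \<bar>f (x t \<omega>) + \<gamma> * \<mu> t / \<rho> * (norm (e t \<omega>))\<^sup>2\<bar>)"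
    proof (rule AE_I2)
      fix \<omega> assume \<omega>: "\<omega> \<in> space M"
      have "0 \<le> \<rho> * \<mu> t / (2 * \<gamma>) * (norm (d t \<omega>))\<^sup>2"
        using \<rho> \<gamma> \<mu>_pos[OF \<open>1 \<le> t\<close>] by simp
      with descent[OF \<open>1 \<le> t\<close> \<omega>] fmin[of "x (t + 1) \<omega>"]
      show "norm (f (x (t + 1) \<omega>)) \<le> norm (\<bar>fmin\<bar> + \<bar>f (x t \<omega>) + \<gamma> * \<mu> t / \<rho> * (norm (e t \<omega>))\<^sup>2\<bar>)"
        unfolding real_norm_def by linarith
    qed
  qed measurable
  moreover have "integrable M (\<lambda>\<omega>. (norm (e (t + 1) \<omega>))\<^sup>2)"
  proof (rule integrableI_bounded)
    have "(\<integral>\<^sup>+ \<omega>. ennreal ((norm (e (t + 1) \<omega>))\<^sup>2) \<partial>M) < \<infinity>"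
      using variance_step[OF \<open>1 \<le> t\<close>] nn_integral_eq_integral[OF integrable_variance_bound[OF \<open>1 \<le> t\<close> f e]]
      by (simp add: order_le_less_trans)
    then show "(\<integral>\<^sup>+ \<omega>. ennreal (norm ((norm (e (t + 1) \<omega>))\<^sup>2)) \<partial>M) < \<infinity>" by simp
  qed measurable
  ultimately show ?case by simp
qed

section \<open>The recursions in expectation\<close>

definition \<Phi> :: "nat \<Rightarrow> real" where
  "\<Phi> t = (\<integral>\<omega>. f (x t \<omega>) \<partial>M)"

definition V :: "nat \<Rightarrow> real" where
  "V t = (\<integral>\<omega>. (norm (e t \<omega>))\<^sup>2 \<partial>M)"

definition \<Delta> :: "nat \<Rightarrow> real" where
  "\<Delta> t = (\<integral>\<omega>. (norm (d t \<omega>))\<^sup>2 \<partial>M)"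

lemma
  assumes "1 \<le> t"
  shows f_int: "integrable M (\<lambda>\<omega>. f (x t \<omega>))" and e_int: "integrable M (\<lambda>\<omega>. (norm (e t \<omega>))\<^sup>2)"
    and d_int: "integrable M (\<lambda>\<omega>. (norm (d t \<omega>))\<^sup>2)"
  using integrable_run[OF assms] integrable_d[OF assms] by auto

lemma V_1: "V 1 \<le> \<sigma>\<^sup>2"
  using variance_init nn_integral_eq_integral[OF e_int[OF order_refl]] by (simp add: V_def)

lemma \<Phi>_1: "\<Phi> 1 = f x\<^sub>1"
proof -
  have "\<Phi> 1 = (\<integral>\<omega>. f x\<^sub>1 \<partial>M)"
    unfolding \<Phi>_def by (intro Bochner_Integration.integral_cong) (simp_all add: init del: One_nat_def)
  then show ?thesis by (simp add: M.prob_space)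
qed

lemma \<Phi>_ge: "1 \<le> t \<Longrightarrow> fmin \<le> \<Phi> t"
  unfolding \<Phi>_def using f_int fmin by (intro M.integral_ge_const) auto

lemma \<Phi>_step:
  assumes t: "1 \<le> t"
  shows "\<Phi> (t + 1) + \<rho> * \<mu> t / (2 * \<gamma>) * \<Delta> t \<le> \<Phi> t + \<gamma> * \<mu> t / \<rho> * V t"
proof -
  note int = f_int[OF le_add2[of 1 t]] f_int[OF t] e_int[OF t] d_int[OF t]
  have "(\<integral>\<omega>. f (x (t + 1) \<omega>) + \<rho> * \<mu> t / (2 * \<gamma>) * (norm (d t \<omega>))\<^sup>2 \<partial>M)
      \<le> (\<integral>\<omega>. f (x t \<omega>) + \<gamma> * \<mu> t / \<rho> * (norm (e t \<omega>))\<^sup>2 \<partial>M)"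
    using int by (intro integral_mono descent t) auto
  then show ?thesis using int by (simp add: \<Phi>_def V_def \<Delta>_def)
qed

lemma V_step:
  assumes t: "1 \<le> t"
  shows "V (t + 1) \<le> (1 - \<alpha> (t + 1))\<^sup>2 * V t + 2 * (\<alpha> (t + 1))\<^sup>2 * \<sigma>\<^sup>2
      + 2 * (1 - \<alpha> (t + 1))\<^sup>2 * (L\<^sup>2 * (\<mu> t)\<^sup>2 * \<Delta> t)"
proof -
  let ?b = "\<lambda>\<omega>. (1 - \<alpha> (t + 1))\<^sup>2 * (norm (e t \<omega>))\<^sup>2 + 2 * (\<alpha> (t + 1))\<^sup>2 * \<sigma>\<^sup>2
      + 2 * (1 - \<alpha> (t + 1))\<^sup>2 * (L * (\<mu> t * norm (d t \<omega>)))\<^sup>2"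
  have int: "integrable M ?b" using f_int[OF t] e_int[OF t] by (rule integrable_variance_bound[OF t])
  have "ennreal (V (t + 1)) = (\<integral>\<^sup>+ \<omega>. ennreal ((norm (e (t + 1) \<omega>))\<^sup>2) \<partial>M)"
    unfolding V_def by (rule nn_integral_eq_integral[OF e_int[OF le_add2], symmetric]) simp
  also note variance_step[OF t]
  also have "(\<integral>\<^sup>+ \<omega>. ennreal (?b \<omega>) \<partial>M) = ennreal (\<integral>\<omega>. ?b \<omega> \<partial>M)"
    by (rule nn_integral_eq_integral[OF int]) simp
  finally have "ennreal (V (t + 1)) \<le> ennreal (\<integral>\<omega>. ?b \<omega> \<partial>M)" .
  then have "V (t + 1) \<le> (\<integral>\<omega>. ?b \<omega> \<partial>M)" by (subst (asm) ennreal_le_iff) auto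
  also have "\<dots> = (1 - \<alpha> (t + 1))\<^sup>2 * V t + 2 * (\<alpha> (t + 1))\<^sup>2 * \<sigma>\<^sup>2
      + 2 * (1 - \<alpha> (t + 1))\<^sup>2 * (L\<^sup>2 * (\<mu> t)\<^sup>2 * \<Delta> t)"
    using e_int[OF t] d_int[OF t] by (simp add: V_def \<Delta>_def power_mult_distrib M.prob_space algebra_simps)
  finally show ?thesis .
qed

lemma V_nonneg: "0 \<le> V t" and \<Delta>_nonneg: "0 \<le> \<Delta> t"
  by (simp_all add: V_def \<Delta>_def)

section \<open>From errors and steps to the gradient norm\<close>

definition Z :: "nat \<Rightarrow> 'a \<Rightarrow> real" where
  "Z t \<omega> = norm (e t \<omega>) / \<rho> + norm (d t \<omega>) / \<gamma>"

lemma Z_measurable: "1 \<le> t \<Longrightarrow> Z t \<in> borel_measurable M"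
  unfolding Z_def using e_measurable[of t] d_measurable[of t] by measurable

text \<open>The first-order equation bounds the estimate by the spectral norm times the step. The
  error is multiplied by the spectral norm over \<rho>, which is at least 1, so that both parts
  share one factor.\<close>

lemma norm_grad_le:
  assumes t: "1 \<le> t" and \<omega>: "\<omega> \<in> space M"
  shows "norm (grad f (x t \<omega>)) \<le> spectral_norm (H t \<omega>) * Z t \<omega>"
proof -
  have "norm (grad f (x t \<omega>)) \<le> norm (e t \<omega>) + norm (g t \<omega>)"
    using norm_triangle_ineq[of "e t \<omega>" "g t \<omega>"] by (simp add: e_def)
  also have "norm (e t \<omega>) \<le> spectral_norm (H t \<omega>) * (norm (e t \<omega>) / \<rho>)"
    using mult_right_mono[OF le_spectral_norm_loewner[OF H_ge[OF t \<omega>]], of "norm (e t \<omega>) / \<rho>"] \<rho> by simp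
  also have "norm (g t \<omega>) \<le> spectral_norm (H t \<omega>) * (norm (d t \<omega>) / \<gamma>)"
    using norm_mult_vec_le_spectral_norm[of "H t \<omega>" "d t \<omega>"] first_order[OF t \<omega>] \<gamma>
    by (simp add: field_simps)
  finally show ?thesis by (simp add: Z_def distrib_left)
qed

lemma Z_second_moment:
  assumes t: "1 \<le> t"
  shows "(\<integral>\<^sup>+ \<omega>. ennreal ((Z t \<omega>)\<^sup>2) \<partial>M) \<le> ennreal (2 * (\<Delta> t / \<gamma>\<^sup>2 + V t / \<rho>\<^sup>2))"
proof -
  note int = e_int[OF t] d_int[OF t]
  have "(Z t \<omega>)\<^sup>2 \<le> 2 * ((norm (d t \<omega>))\<^sup>2 / \<gamma>\<^sup>2 + (norm (e t \<omega>))\<^sup>2 / \<rho>\<^sup>2)" for \<omega>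
    using power2_norm_add_le[of "norm (e t \<omega>) / \<rho>" "norm (d t \<omega>) / \<gamma>"]
    by (simp add: Z_def power_divide)
  then have "(\<integral>\<^sup>+ \<omega>. ennreal ((Z t \<omega>)\<^sup>2) \<partial>M)
      \<le> (\<integral>\<^sup>+ \<omega>. ennreal (2 * ((norm (d t \<omega>))\<^sup>2 / \<gamma>\<^sup>2 + (norm (e t \<omega>))\<^sup>2 / \<rho>\<^sup>2)) \<partial>M)"
    by (intro nn_integral_mono ennreal_leI)
  also have "\<dots> = ennreal (2 * (\<Delta> t / \<gamma>\<^sup>2 + V t / \<rho>\<^sup>2))"
    using int by (subst nn_integral_eq_integral) (simp_all add: V_def \<Delta>_def)
  finally show ?thesis .
qed

lemma gradient_mean_bound:
  assumes sum: "(\<Sum>t=1..N. 2 * (\<Delta> t / \<gamma>\<^sup>2 + V t / \<rho>\<^sup>2)) \<le> real N * B\<^sup>2"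
    and B: "0 < B" and N: "0 < N"
  shows "1 / of_nat N * (\<Sum>t=1..N. \<integral>\<^sup>+ \<omega>. ennreal (norm (grad f (x t \<omega>))) \<partial>M)
    \<le> ennreal_sqrt (1 / of_nat N * (\<Sum>t=1..N. \<integral>\<^sup>+ \<omega>. ennreal ((spectral_norm (H t \<omega>))\<^sup>2) \<partial>M)) * ennreal B"
proof (rule nn_integral_mean_le_Cauchy_Schwarz[where z = Z])
  have "(\<Sum>t=1..N. \<integral>\<^sup>+ \<omega>. ennreal ((Z t \<omega>)\<^sup>2) \<partial>M) \<le> (\<Sum>t=1..N. ennreal (2 * (\<Delta> t / \<gamma>\<^sup>2 + V t / \<rho>\<^sup>2)))"
    by (intro sum_mono Z_second_moment) auto
  also have "\<dots> = ennreal (\<Sum>t=1..N. 2 * (\<Delta> t / \<gamma>\<^sup>2 + V t / \<rho>\<^sup>2))"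
    by (intro sum_ennreal) (simp add: V_nonneg \<Delta>_nonneg)
  also have "\<dots> \<le> ennreal (real N * B\<^sup>2)" using sum by (rule ennreal_leI)
  finally show "(\<Sum>t=1..N. \<integral>\<^sup>+ \<omega>. ennreal ((Z t \<omega>)\<^sup>2) \<partial>M) \<le> ennreal (real N * B\<^sup>2)" .
  \<comment> \<open>The lower bound on \<open>H 1\<close> keeps the total second moment away from
    zero, as the division in the weight \<kappa> demands.\<close>
  have "ennreal (\<rho>\<^sup>2) = (\<integral>\<^sup>+ \<omega>. ennreal (\<rho>\<^sup>2) \<partial>M)" by (simp add: M.emeasure_space_1)
  also have "\<dots> \<le> (\<integral>\<^sup>+ \<omega>. ennreal ((spectral_norm (H 1 \<omega>))\<^sup>2) \<partial>M)"
    by (intro nn_integral_mono ennreal_leI power_mono le_spectral_norm_loewner H_ge) (use \<rho> in auto)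
  finally have "(\<integral>\<^sup>+ \<omega>. ennreal ((spectral_norm (H 1 \<omega>))\<^sup>2) \<partial>M) \<noteq> 0"
    using \<rho> by (auto simp: ennreal_eq_0_iff)
  then show "(\<Sum>t=1..N. \<integral>\<^sup>+ \<omega>. ennreal ((spectral_norm (H t \<omega>))\<^sup>2) \<partial>M) \<noteq> 0"
    using N by (subst sum_eq_0_iff) auto
  show "(\<lambda>\<omega>. spectral_norm (H t \<omega>)) \<in> borel_measurable M" if "t \<in> {1..N}" for t
    using H_measurable[of t] that by auto
qed (use B N Z_measurable norm_grad_le in auto)

end

section \<open>The convergence rate\<close>

text \<open>With \<open>r\<close> and \<open>v\<close> the sixth roots of \<open>m\<close> and of
  the horizon, all fractional powers become integer ones. The estimate is then
  \<open>r\<^sup>2 + v\<^sup>2 \<le> (r + v)\<^sup>2\<close>.\<close>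

lemma root_sum_bound:
  fixes r v \<rho> G' :: real
  assumes "0 < r" "0 < v" "0 < \<rho>" "0 \<le> G'"
  shows "8 * G' * (r\<^sup>2 + v\<^sup>2) / (\<rho>\<^sup>2 * r\<^sup>2)
    \<le> v ^ 6 * ((2 * sqrt (2 * G') / v ^ 3 + 2 * sqrt (2 * G') / (r * v\<^sup>2)) / \<rho>)\<^sup>2"
proof -
  define s where "s = sqrt (2 * G')"
  have s: "s\<^sup>2 = 2 * G'" using assms by (simp add: s_def)
  have "2 * s / v ^ 3 + 2 * s / (r * v\<^sup>2) = 2 * s * (r + v) / (r * v ^ 3)"
    using assms by (simp add: field_simps power2_eq_square power3_eq_cube)
  then have "v ^ 6 * ((2 * s / v ^ 3 + 2 * s / (r * v\<^sup>2)) / \<rho>)\<^sup>2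
      = v ^ 6 * (2 * s * (r + v) / (r * v ^ 3 * \<rho>))\<^sup>2" by simp
  also have "\<dots> = 4 * s\<^sup>2 * (r + v)\<^sup>2 / (\<rho>\<^sup>2 * r\<^sup>2)"
  proof -
    have "v ^ 6 * (a / (r * v ^ 3 * \<rho>))\<^sup>2 = a\<^sup>2 / (\<rho>\<^sup>2 * r\<^sup>2)" for a
      using assms by (simp add: power_divide power_mult_distrib flip: power_mult)
    then show ?thesis by (simp add: power_mult_distrib)
  qed
  also have "\<dots> \<ge> 4 * s\<^sup>2 * (r\<^sup>2 + v\<^sup>2) / (\<rho>\<^sup>2 * r\<^sup>2)"
    using assms by (intro divide_right_mono mult_left_mono) (auto simp: power2_sum)
  finally show ?thesis unfolding s_def[symmetric] s by simp
qed

theorem corollary1: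
  fixes M :: "'a measure" and D :: "'b measure"
    and F :: "real ^ 'n \<Rightarrow> 'b \<Rightarrow> real" and f :: "real ^ 'n \<Rightarrow> real"
    and \<mu> \<alpha> :: "nat \<Rightarrow> real" and x\<^sub>1 :: "real ^ 'n"
    and \<xi> :: "nat \<Rightarrow> 'a \<Rightarrow> 'b" and H :: "nat \<Rightarrow> 'a \<Rightarrow> real ^ 'n ^ 'n"
    and xt x g :: "nat \<Rightarrow> 'a \<Rightarrow> real ^ 'n"
    and \<gamma> \<sigma> \<rho> L k m \<nu> c fstar G' :: real and T :: nat
  assumes run: "super_adam M D F UNIV 1 \<gamma> \<mu> \<alpha> x\<^sub>1 \<xi> H xt x g"
    and F_diff: "\<And>y s. s \<in> space D \<Longrightarrow> (\<lambda>z. F z s) differentiable (at y)"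
    and F_integrable: "\<And>y. integrable D (F y)"
    and f_def: "\<And>y. f y = (\<integral>s. F y s \<partial>D)"
    and f_diff: "\<And>y. f differentiable (at y)"
    and \<sigma>: "\<sigma> > 0"
    and unbiased: "\<And>y. has_bochner_integral D (\<lambda>s. grad (\<lambda>z. F z s) y) (grad f y)"
    and variance: "\<And>y. (\<integral>\<^sup>+ s. ennreal ((norm (grad (\<lambda>z. F z s) y - grad f y))\<^sup>2) \<partial>D)
                          \<le> ennreal (\<sigma>\<^sup>2)"
    and f_bdd: "bdd_below (range f)"
    and fstar: "fstar = (INF y. f y)"
    and \<rho>: "\<rho> > 0"
    and H_ge: "\<And>t \<omega>. t \<ge> 1 \<Longrightarrow> \<omega> \<in> space M \<Longrightarrow> loewner_le (\<rho> *\<^sub>R mat 1) (H t \<omega>)"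
    and L: "L > 0"
    and lipschitz: "\<And>s y z. s \<in> space D \<Longrightarrow>
          norm (grad (\<lambda>w. F w s) y - grad (\<lambda>w. F w s) z) \<le> L * norm (y - z)"
    and k: "k > 0"
    and m: "m \<ge> Max {3 / 2, k ^ 3, 8 powr (3 / 2) / (3 * k) powr (3 / 2)}"
    and \<nu>: "\<nu> \<ge> 4"
    and \<gamma>: "\<gamma> = \<rho> * m powr (1 / 3) / (\<nu> * k * L)"
    and c_lower: "1 / k ^ 3 + 10 * L\<^sup>2 * \<gamma>\<^sup>2 / \<rho>\<^sup>2 \<le> c"
    and c_upper: "c \<le> m powr (2 / 3) / k\<^sup>2"
    and \<mu>: "\<And>t. \<mu> t = k / (m + real t) powr (1 / 3)"
    and \<alpha>: "\<And>t. \<alpha> (t + 1) = c * (\<mu> t)\<^sup>2"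
    and G': "G' = \<nu> * L * (f x\<^sub>1 - fstar) + \<nu>\<^sup>2 * \<sigma>\<^sup>2 / 8
                  + \<nu>\<^sup>2 * k ^ 4 * c\<^sup>2 * \<sigma>\<^sup>2 / (4 * m powr (1 / 3)) * ln (m + real T)"
    and T: "T \<ge> 1"
  shows "1 / of_nat T * (\<Sum>t=1..T. \<integral>\<^sup>+ \<omega>. ennreal (norm (grad f (x t \<omega>))) \<partial>M)
    \<le> ennreal_sqrt (1 / of_nat T * (\<Sum>t=1..T. \<integral>\<^sup>+ \<omega>. ennreal ((spectral_norm (H t \<omega>))\<^sup>2) \<partial>M))
        / ennreal \<rho>
      * ennreal (2 * sqrt (2 * G') / real T powr (1 / 2)
                 + 2 * sqrt (2 * G') / (m powr (1 / 6) * real T powr (1 / 3)))"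
proof -
  define p where "p = m powr (1 / 3)"
  define s where "s = (m + real T) powr (1 / 3)"
  have m32: "3 / 2 \<le> m" and mk: "k ^ 3 \<le> m" using m by simp_all
  have p: "0 < p" "p ^ 3 = m" using m32 powr_third_cubed[of m] by (auto simp: p_def)
  have s: "0 < s" "s ^ 3 = m + real T"
    using m32 powr_third_cubed[of "m + real T"] by (auto simp: s_def)
  have kp: "k \<le> p"
    using mk p power_mono_iff[of k p 3] k by simp
  have \<gamma>0: "0 < \<gamma>" and \<alpha>01: "\<And>t. 1 \<le> t \<Longrightarrow> \<alpha> (t + 1) \<in> {0<..1}"
    using run by (simp_all add: super_adam_def)
  have \<gamma>': "\<gamma> = \<rho> * p / (\<nu> * k * L)" using \<gamma> by (simp add: p_def)
  have \<mu>_pos: "0 < \<mu> t" for t using k m32 by (simp add: \<mu>)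
  have \<mu>_mono: "\<mu> t \<le> \<mu> t'" if "t' \<le> t" for t t'
    unfolding \<mu> using k m32 that by (intro divide_left_mono powr_mono2 mult_pos_pos) auto
  have \<mu>0: "\<mu> 0 = k / p" by (simp add: \<mu> p_def)
  have \<mu>T: "\<mu> T = k / s" by (simp add: \<mu> s_def)
  have fstar_le: "fstar \<le> f y" for y
    unfolding fstar using f_bdd by (intro cINF_lower) auto
  \<comment> \<open>The step size is largest at index 0, where it equals \<open>k / p\<close>; in
    the same terms the cap is \<open>\<nu> * k / (2 * p)\<close>.\<close>
  have \<mu>_le: "\<mu> t \<le> \<rho> / (2 * L * \<gamma>)" if "1 \<le> t" for t
  proof -
    have "\<mu> t \<le> \<mu> 0" by (rule \<mu>_mono) simp
    also have "\<dots> = 2 * k / (2 * p)" using p by (simp add: \<mu>0)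
    also have "\<dots> \<le> \<nu> * k / (2 * p)"
      using \<nu> k p by (intro divide_right_mono mult_right_mono) auto
    also have "\<dots> = \<rho> / (2 * L * \<gamma>)" using \<nu> k p L \<rho> by (simp add: \<gamma>')
    finally show ?thesis .
  qed
  interpret S: super_adam_run M D F f \<mu> \<alpha> x\<^sub>1 \<xi> H xt x g \<gamma> \<sigma> \<rho> L fstar
    by unfold_locales (fact run f_diff unbiased variance fstar_le \<rho> H_ge L lipschitz \<mu>_le)+
  \<comment> \<open>Since \<open>(1 - \<alpha>)\<^sup>2 \<le> 1 - \<alpha>\<close>, passing to the
    next weight gains \<open>c * \<mu> t\<close>. The two summands of the lower bound on
    \<open>c\<close> pay for the growth of \<open>1 / \<mu> t\<close> and for the required surplus,
    respectively.\<close>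
  have drift: "(1 - \<alpha> (t + 1))\<^sup>2 / \<mu> t + 10 * L\<^sup>2 * \<gamma>\<^sup>2 / \<rho>\<^sup>2 * \<mu> t \<le> 1 / \<mu> (t - 1)" if t: "1 \<le> t" for t
  proof -
    define u v where "u = (m + real t) powr (1 / 3)" and "v = (m + real (t - 1)) powr (1 / 3)"
    have u: "u ^ 3 = m + real t" and v: "v ^ 3 = m + real (t - 1)"
      using m32 by (auto simp: u_def v_def intro!: powr_third_cubed)
    have u0: "0 < u" using m32 by (simp add: u_def)
    have "p \<le> u" "v \<le> u"
      using m32 by (auto simp: p_def u_def v_def intro!: powr_mono2)
    then have step: "u / k - v / k \<le> 1 / (k\<^sup>2 * u)"
      using k kp u v t by (intro cube_root_step_le) (auto simp: v_def of_nat_diff)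
    have \<mu>t: "\<mu> t = k / u" and \<mu>t': "\<mu> (t - 1) = k / v" by (auto simp: \<mu> u_def v_def)
    have "(1 - \<alpha> (t + 1))\<^sup>2 \<le> 1 * (1 - \<alpha> (t + 1))"
      unfolding power2_eq_square using \<alpha>01[OF t] by (intro mult_right_mono) auto
    then have "(1 - \<alpha> (t + 1))\<^sup>2 / \<mu> t \<le> (1 - \<alpha> (t + 1)) / \<mu> t"
      using \<mu>_pos[of t] by (intro divide_right_mono) auto
    also have "\<dots> = 1 / \<mu> t - c * \<mu> t"
      using \<mu>_pos[of t] by (simp add: \<alpha>[simplified] diff_divide_distrib power2_eq_square)
    finally have 1: "(1 - \<alpha> (t + 1))\<^sup>2 / \<mu> t \<le> 1 / \<mu> t - c * \<mu> t" .
    have "(1 / k ^ 3 + 10 * L\<^sup>2 * \<gamma>\<^sup>2 / \<rho>\<^sup>2) * \<mu> t \<le> c * \<mu> t"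
      using c_lower \<mu>_pos[of t] by (intro mult_right_mono) auto
    moreover have "1 / k ^ 3 * \<mu> t = 1 / (k\<^sup>2 * u)"
      using k by (simp add: \<mu>t power3_eq_cube power2_eq_square)
    moreover have "1 / \<mu> t - 1 / \<mu> (t - 1) \<le> 1 / (k\<^sup>2 * u)"
      unfolding \<mu>t \<mu>t' using step by simp
    ultimately show ?thesis using 1 by (simp add: distrib_right)
  qed
  define R where "R = (\<Sum>t=1..T. S.\<Delta> t / \<gamma>\<^sup>2 + S.V t / \<rho>\<^sup>2)"
  define q where "q = \<rho> / (8 * \<gamma> * L\<^sup>2)"
  have q: "0 < q" using \<rho> \<gamma>0 L by (simp add: q_def)
  have lyap: "S.\<Phi> (T + 1) + q / \<mu> T * S.V (T + 1)
      + (\<Sum>t=1..T. \<mu> t * (\<rho> / (4 * \<gamma>) * S.\<Delta> t + \<gamma> / (4 * \<rho>) * S.V t))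
    \<le> S.\<Phi> 1 + q / \<mu> 0 * S.V 1 + (\<Sum>t=1..T. 2 * q * c\<^sup>2 * \<sigma>\<^sup>2 * (\<mu> t) ^ 3)"
    using lyapunov_sum[where \<Phi> = S.\<Phi> and V = S.V and \<Delta> = S.\<Delta> and \<mu> = \<mu> and \<alpha> = \<alpha> and n = T
        and c = c and \<sigma> = \<sigma>, OF \<rho> \<gamma>0 L \<mu>_pos S.V_nonneg S.\<Delta>_nonneg \<alpha> \<alpha>01 drift S.\<Phi>_step S.V_step]
    by (simp add: q_def mult.assoc)
  have sum_cubes: "(\<Sum>t=1..T. 2 * q * c\<^sup>2 * \<sigma>\<^sup>2 * (\<mu> t) ^ 3) \<le> 2 * q * c\<^sup>2 * \<sigma>\<^sup>2 * k ^ 3 * ln (m + real T)"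
  proof -
    have "(\<mu> t) ^ 3 = k ^ 3 * (1 / (m + real t))" for t
      using m32 powr_third_cubed[of "m + real t"] by (simp add: \<mu> power_divide)
    then have "(\<Sum>t=1..T. 2 * q * c\<^sup>2 * \<sigma>\<^sup>2 * (\<mu> t) ^ 3)
        = 2 * q * c\<^sup>2 * \<sigma>\<^sup>2 * k ^ 3 * (\<Sum>t=1..T. 1 / (m + real t))"
      by (simp add: sum_distrib_left mult.assoc)
    also have "\<dots> \<le> 2 * q * c\<^sup>2 * \<sigma>\<^sup>2 * k ^ 3 * ln (m + real T)"
      using m32 q k by (intro mult_left_mono sum_inverse_le_ln) auto
    finally show ?thesis .
  qed
  \<comment> \<open>The step sizes decrease, so \<open>\<mu> T\<close> bounds all of them from below
    and can be pulled out of the sum.\<close>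
  have "\<mu> T * (\<rho> * \<gamma> / 4) * R \<le> (\<Sum>t=1..T. \<mu> t * (\<rho> / (4 * \<gamma>) * S.\<Delta> t + \<gamma> / (4 * \<rho>) * S.V t))"
    unfolding R_def sum_distrib_left
  proof (rule sum_mono)
    fix t assume "t \<in> {1..T}"
    have "\<mu> T * (\<rho> * \<gamma> / 4) * (S.\<Delta> t / \<gamma>\<^sup>2 + S.V t / \<rho>\<^sup>2) = \<mu> T * (\<rho> / (4 * \<gamma>) * S.\<Delta> t + \<gamma> / (4 * \<rho>) * S.V t)"
      using \<rho> \<gamma>0 by (simp add: field_simps power2_eq_square)
    also have "\<dots> \<le> \<mu> t * (\<rho> / (4 * \<gamma>) * S.\<Delta> t + \<gamma> / (4 * \<rho>) * S.V t)"
      using \<rho> \<gamma>0 S.V_nonneg S.\<Delta>_nonneg \<open>t \<in> {1..T}\<close> by (intro mult_right_mono \<mu>_mono) auto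
    finally show "\<mu> T * (\<rho> * \<gamma> / 4) * (S.\<Delta> t / \<gamma>\<^sup>2 + S.V t / \<rho>\<^sup>2)
        \<le> \<mu> t * (\<rho> / (4 * \<gamma>) * S.\<Delta> t + \<gamma> / (4 * \<rho>) * S.V t)" .
  qed
  moreover have "0 \<le> q / \<mu> T * S.V (T + 1)" using q \<mu>_pos[of T] S.V_nonneg by simp
  moreover have "q / \<mu> 0 * S.V 1 \<le> q / \<mu> 0 * \<sigma>\<^sup>2"
    using q \<mu>_pos[of 0] S.V_1 by (intro mult_left_mono) auto
  moreover have "fstar \<le> S.\<Phi> (T + 1)" by (rule S.\<Phi>_ge) simp
  ultimately have "\<mu> T * (\<rho> * \<gamma> / 4) * R
      \<le> (f x\<^sub>1 - fstar) + q / \<mu> 0 * \<sigma>\<^sup>2 + 2 * q * c\<^sup>2 * \<sigma>\<^sup>2 * k ^ 3 * ln (m + real T)"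
    using lyap sum_cubes S.\<Phi>_1 by linarith
  \<comment> \<open>Inserting \<gamma> gives \<open>q = \<nu> * k / (8 * p * L)\<close>; the three
    summands of \<open>G'\<close> are the three terms above multiplied by
    \<open>\<nu> * L\<close>.\<close>
  also have "\<dots> = G' / (\<nu> * L)"
  proof -
    have "q / \<mu> 0 * \<sigma>\<^sup>2 = (\<nu>\<^sup>2 * \<sigma>\<^sup>2 / 8) / (\<nu> * L)"
      using p k \<nu> L \<rho> by (simp add: q_def \<mu>0 \<gamma>' field_simps power2_eq_square)
    moreover have "2 * q * c\<^sup>2 * \<sigma>\<^sup>2 * k ^ 3 = (\<nu>\<^sup>2 * k ^ 4 * c\<^sup>2 * \<sigma>\<^sup>2 / (4 * p)) / (\<nu> * L)"
      using p k \<nu> L \<rho> by (simp add: q_def \<gamma>' field_simps power2_eq_square eval_nat_numeral)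
    moreover have "f x\<^sub>1 - fstar = (\<nu> * L * (f x\<^sub>1 - fstar)) / (\<nu> * L)"
      using \<nu> L by simp
    ultimately show ?thesis
      unfolding G' p_def[symmetric] by (simp only: add_divide_distrib times_divide_eq_left)
  qed
  finally have "\<mu> T * (\<rho> * \<gamma> / 4) * R \<le> G' / (\<nu> * L)" .
  moreover have "\<mu> T * (\<rho> * \<gamma> / 4) = \<rho>\<^sup>2 * p / (4 * s * \<nu> * L)"
    using k by (simp add: \<mu>T \<gamma>' power2_eq_square)
  ultimately have "\<rho>\<^sup>2 * p / (4 * s * \<nu> * L) * R \<le> G' / (\<nu> * L)" by (simp only:)
  then have "(4 * s * \<nu> * L / (\<rho>\<^sup>2 * p)) * (\<rho>\<^sup>2 * p / (4 * s * \<nu> * L) * R)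
      \<le> (4 * s * \<nu> * L / (\<rho>\<^sup>2 * p)) * (G' / (\<nu> * L))"
    using s \<nu> L p \<rho> by (intro mult_left_mono) auto
  then have R: "R \<le> 4 * G' * s / (\<rho>\<^sup>2 * p)"
    using s \<nu> L p \<rho> by (simp add: mult_ac)
  \<comment> \<open>Strictness comes from the positive noise level, and it yields
    \<open>0 < B\<close> below.\<close>
  have G'_pos: "0 < G'"
  proof -
    have "0 \<le> \<nu> * L * (f x\<^sub>1 - fstar)" using \<nu> L fstar_le[of x\<^sub>1] by simp
    moreover have "0 < \<nu>\<^sup>2 * \<sigma>\<^sup>2 / 8" using \<nu> \<sigma> by simp
    moreover have "0 \<le> \<nu>\<^sup>2 * k ^ 4 * c\<^sup>2 * \<sigma>\<^sup>2 / (4 * m powr (1 / 3)) * ln (m + real T)"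
      using m32 by simp
    ultimately show ?thesis unfolding G' by linarith
  qed
  define r v where "r = m powr (1 / 6)" and "v = real T powr (1 / 6)"
  have rv: "0 < r" "0 < v" using m32 T by (auto simp: r_def v_def)
  have powers: "p = r\<^sup>2" "v ^ 6 = real T" "real T powr (1 / 2) = v ^ 3" "real T powr (1 / 3) = v\<^sup>2"
    using m32 T by (simp_all add: p_def r_def v_def powr_powr flip: powr_realpow)
  \<comment> \<open>Subadditivity of the cube root, checked by cubing. It splits the growth of
    \<open>1 / \<mu> T\<close> into a part from \<open>m\<close> and a part from \<open>T\<close>,
    the origin of the two rates.\<close>
  have "s \<le> r\<^sup>2 + v\<^sup>2"
  proof (rule power_le_imp_le_base)
    have "s ^ Suc 2 = (r\<^sup>2) ^ 3 + (v\<^sup>2) ^ 3"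
      using s p powers by (simp flip: power_mult)
    also have "\<dots> \<le> (r\<^sup>2 + v\<^sup>2) ^ 3"
      using rv by (simp add: power3_eq_cube algebra_simps)
    finally show "s ^ Suc 2 \<le> (r\<^sup>2 + v\<^sup>2) ^ Suc 2" by simp
  qed simp
  define B where "B = (2 * sqrt (2 * G') / real T powr (1 / 2)
      + 2 * sqrt (2 * G') / (m powr (1 / 6) * real T powr (1 / 3))) / \<rho>"
  have B: "0 < B" using G'_pos T m32 \<rho> by (auto simp: B_def intro!: divide_pos_pos add_pos_pos)
  have "(\<Sum>t=1..T. 2 * (S.\<Delta> t / \<gamma>\<^sup>2 + S.V t / \<rho>\<^sup>2)) = 2 * R"
    by (simp add: R_def sum_distrib_left)
  also have "\<dots> \<le> 8 * G' * s / (\<rho>\<^sup>2 * p)" using R by simp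
  also have "\<dots> \<le> 8 * G' * (r\<^sup>2 + v\<^sup>2) / (\<rho>\<^sup>2 * r\<^sup>2)"
    unfolding powers using \<open>s \<le> r\<^sup>2 + v\<^sup>2\<close> G'_pos \<rho> by (intro divide_right_mono mult_left_mono) auto
  also have "\<dots> \<le> real T * B\<^sup>2"
    using root_sum_bound[OF rv \<rho>, of G'] G'_pos unfolding B_def powers r_def[symmetric] by simp
  finally have "1 / of_nat T * (\<Sum>t=1..T. \<integral>\<^sup>+ \<omega>. ennreal (norm (grad f (x t \<omega>))) \<partial>M)
    \<le> ennreal_sqrt (1 / of_nat T * (\<Sum>t=1..T. \<integral>\<^sup>+ \<omega>. ennreal ((spectral_norm (H t \<omega>))\<^sup>2) \<partial>M)) * ennreal B"
    using B T by (intro S.gradient_mean_bound) auto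
  also have "ennreal B = ennreal (B * \<rho>) / ennreal \<rho>"
    using B \<rho> by (simp add: divide_ennreal)
  also have "B * \<rho> = 2 * sqrt (2 * G') / real T powr (1 / 2)
      + 2 * sqrt (2 * G') / (m powr (1 / 6) * real T powr (1 / 3))"
    using \<rho> by (simp add: B_def)
  finally show ?thesis
    by (simp only: divide_ennreal_def mult_ac)
qed

end
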